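(* The following three parameterized problems are in FPT: given a directed graph $G$, nodes $s,t$, and parameter $k\in\mathbb N$, decide whether there is a trail from $s$ to $t$ in $G$ of length exactly $k$; of length at most $k$; of length at least $k$, respectively.
   Context: A trail is a path (sequence of consecutive directed edges) with no repeated edge; its length is its number of edges. A parameterized problem is in FPT if it can be decided in time $f(k)\cdot n^{c}$ for a computable $f$, a constant $c$, and input size $n$. *)

theory Defs
  imports Main
begin

fun is_walk :: "(nat \<times> nat) set \<Rightarrow> nat \<Rightarrow> nat \<Rightarrow> (nat \<times> nat) list \<Rightarrow> bool" where
  "is_walk E s t [] \<longleftrightarrow> s = t"
| "is_walk E s t (e # es) \<longleftrightarrow> fst e = s \<and> e \<in> E \<and> is_walk E (snd e) t es"

definition is_trail :: "(nat \<times> nat) set \<Rightarrow> nat \<Rightarrow> nat \<Rightarrow> (nat \<times> nat) list \<Rightarrow> bool" where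
  "is_trail E s t es \<longleftrightarrow> is_walk E s t es \<and> distinct es"

datatype instr =
    LOADC nat nat
  | ADD nat nat nat
  | SUB nat nat nat
  | LOADI nat nat
  | STOREI nat nat
  | READ nat nat
  | JZ nat nat

type_synonym config = "nat \<times> (nat \<Rightarrow> nat)"

definition read_input :: "nat list \<Rightarrow> nat \<Rightarrow> nat" where
  "read_input inp i = (if i < length inp then inp ! i else 0)"

fun exec :: "nat list \<Rightarrow> instr \<Rightarrow> config \<Rightarrow> config" where
  "exec inp (LOADC r c) (pc, m) = (Suc pc, m(r := c))"
| "exec inp (ADD r a b) (pc, m) = (Suc pc, m(r := m a + m b))"
| "exec inp (SUB r a b) (pc, m) = (Suc pc, m(r := m a - m b))"
| "exec inp (LOADI r a) (pc, m) = (Suc pc, m(r := m (m a)))"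
| "exec inp (STOREI a b) (pc, m) = (Suc pc, m(m a := m b))"
| "exec inp (READ r a) (pc, m) = (Suc pc, m(r := read_input inp (m a)))"
| "exec inp (JZ r l) (pc, m) = (if m r = 0 then l else Suc pc, m)"

definition ram_step :: "instr list \<Rightarrow> nat list \<Rightarrow> config \<Rightarrow> config" where
  "ram_step P inp c = (if fst c < length P then exec inp (P ! fst c) c else c)"

definition ram_run :: "instr list \<Rightarrow> nat list \<Rightarrow> nat \<Rightarrow> config" where
  "ram_run P inp T = (ram_step P inp ^^ T) (0, (\<lambda>_. 0)(0 := length inp))"

definition ram_halted_within :: "instr list \<Rightarrow> nat list \<Rightarrow> nat \<Rightarrow> bool" where
  "ram_halted_within P inp T \<longleftrightarrow> length P \<le> fst (ram_run P inp T)"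

definition ram_decides_within :: "instr list \<Rightarrow> nat list \<Rightarrow> nat \<Rightarrow> bool \<Rightarrow> bool" where
  "ram_decides_within P inp T b \<longleftrightarrow>
     ram_halted_within P inp T \<and> (snd (ram_run P inp T) 0 = 1 \<longleftrightarrow> b)"

definition ram_computable :: "(nat \<Rightarrow> nat) \<Rightarrow> bool" where
  "ram_computable f \<longleftrightarrow> (\<exists>Q. \<forall>k. \<exists>T. ram_halted_within Q [k] T \<and> snd (ram_run Q [k] T) 0 = f k)"

definition graph_encodings :: "nat \<Rightarrow> (nat \<times> nat) set \<Rightarrow> nat \<Rightarrow> nat \<Rightarrow> nat \<Rightarrow> nat list set" where
  "graph_encodings n E s t k =
     {[n, s, t, k, length es] @ concat (map (\<lambda>(u, v). [u, v]) es) | es. distinct es \<and> set es = E}"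

definition valid_instance :: "nat \<Rightarrow> (nat \<times> nat) set \<Rightarrow> nat \<Rightarrow> nat \<Rightarrow> bool" where
  "valid_instance n E s t \<longleftrightarrow> E \<subseteq> {..<n} \<times> {..<n} \<and> s < n \<and> t < n"

text \<open>A parameterized graph problem Q (parameter k) is in FPT if some RAM program decides it
  in time f(k) * |x|^c, f computable, with |x| = n + |E| + 1.\<close>
definition fpt_graph_problem :: "(nat \<Rightarrow> (nat \<times> nat) set \<Rightarrow> nat \<Rightarrow> nat \<Rightarrow> nat \<Rightarrow> bool) \<Rightarrow> bool" where
  "fpt_graph_problem Q \<longleftrightarrow>
     (\<exists>P f c. ram_computable f \<and>
        (\<forall>n E s t k inp. valid_instance n E s t \<longrightarrow> inp \<in> graph_encodings n E s t k \<longrightarrow>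
           ram_decides_within P inp (f k * (n + card E + 1) ^ c) (Q n E s t k)))"

end

(*
  All three problems ask for a trail of length between K1 and K1 + K2, where (K1, K2) is (k, 0), (0, k)
  and (k, |E|).  A shortest such trail R is found by colour coding: colour the e-th edge by e mod q and
  guess q, the vertex v that R reaches after K1 edges, and the colours of these K1 edges.  For a suitable
  q = O(k^2 log |E|) the first K1 and the last K1 edges of R have different colours.  Then any walk P' from
  s to v with the guessed colours is a trail that avoids the last K1 edges of R, and if P' met another later
  edge of R, switching from P' to R there would give a shorter trail that still has K1 edges.  So it
  remains to search for a walk of at most K2 edges from v to t that avoids P'.
  There are only |V| (2^k log |E|)^O(k) guesses, and (log |E|)^k <= k^k O(|E|).
*)
theory Submission
  imports Defs Complex_Main
begin

text \<open>The hard case is length at least \<open>k\<close>: a shortest solution can be longer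
  than any function of \<open>k\<close>, so colours cannot separate all of its edges, and minimality
  has to protect those in the middle. The end is protected by colours for the sake of the lower
  bound: an exchange then happens only where at least \<open>K1\<close> edges are still to come, so
  the new trail is long enough however short its new prefix is. Residues serve as colours because a
  modulus is one small number that can be enumerated. A suitable modulus exists because a positive
  number with few bits cannot be divisible by all of 1, ..., \<open>B - 1\<close>. Every walk with
  the colours of a good guess serves, so one walk found by dynamic programming is enough. Bad
  guesses are harmless, since the walk that is found gets checked. The second part may be any walk:
  cutting out its repetitions cannot push the total below \<open>K1\<close>, which the first part
  reaches alone.\<close>

section \<open>Separating small sets by residues\<close>

text \<open>With entries \<open>1 / (m * (n choose m))\<close>, each entry of row
  \<open>n - 1\<close> is the sum of two neighbours in row \<open>n\<close>. Solved for the right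
  neighbour, this computes column \<open>m + 1\<close> from column \<open>m\<close>.\<close>

lemma Leibniz_triangle:
  assumes "1 \<le> m" "m < n"
  shows "1 / real (Suc m * (n choose Suc m)) = 1 / real (m * ((n - 1) choose m)) - 1 / real (m * (n choose m))"
proof -
  obtain n' where n: "n = Suc n'" using assms by (cases n) auto
  have p: "n' choose m > 0" "n choose m > 0" "n choose Suc m > 0"
    using assms n by (auto simp: zero_less_binomial_iff simp del: binomial_Suc_Suc)
  have a: "Suc m * (n choose Suc m) = n * (n' choose m)"
    unfolding n using Suc_times_binomial_eq[of n' m] by (simp add: mult.commute)
  have b: "(n - m) * (n choose m) = n * (n' choose m)"
    using binomial_absorb_comp[of n m] n by simp
  have b': "real (n choose m) = real n * real (n' choose m) / (real n - real m)"
  proof -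
    have "(real n - real m) * real (n choose m) = real n * real (n' choose m)"
      using b assms by (metis of_nat_diff of_nat_mult less_imp_le)
    then show ?thesis using assms by (simp add: field_simps)
  qed
  have pn: "real n > real m" "real m > 0" using assms by auto
  have pc: "real (n' choose m) > 0" using p by simp
  have "1 / real (m * (n' choose m)) - 1 / real (m * (n choose m))
      = 1 / (real m * real (n' choose m)) - (real n - real m) / (real m * real n * real (n' choose m))"
    unfolding of_nat_mult b' by simp
  also have "\<dots> = 1 / (real n * real (n' choose m))"
    using pn pc by (simp add: field_simps)
  also have "\<dots> = 1 / real (Suc m * (n choose Suc m))" unfolding a by simp
  finally show ?thesis using n by simp
qed

text \<open>Nair's lower bound for \<open>lcm(1, \<dots>, n)\<close>, via the Leibniz harmonic triangle.\<close>

lemma binomial_dvd_common_multiple: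
  fixes D :: nat
  assumes "\<And>i. 1 \<le> i \<Longrightarrow> i \<le> n \<Longrightarrow> i dvd D" "1 \<le> m" "m \<le> n"
  shows "real D / real (m * (n choose m)) \<in> \<int>"
  using assms
proof (induction m arbitrary: n)
  case (Suc m)
  show ?case
  proof (cases "m = 0")
    case True
    \<comment> \<open>Column 1 consists of the numbers \<open>1 / n\<close>, which \<open>D\<close>
      clears by assumption; later columns are differences of earlier ones.\<close>
    have "n dvd D" using Suc.prems by simp
    then obtain r where "D = n * r" by (elim dvdE)
    then have "real D / real (Suc m * (n choose Suc m)) = real r" using True Suc.prems by simp
    then show ?thesis by simp
  next
    case False
    have "real D / real (m * ((n - 1) choose m)) \<in> \<int>"
      by (rule Suc.IH) (use Suc.prems False in auto)
    moreover have "real D / real (m * (n choose m)) \<in> \<int>"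
      by (rule Suc.IH) (use Suc.prems False in auto)
    ultimately have "real D / real (m * ((n - 1) choose m)) - real D / real (m * (n choose m)) \<in> \<int>"
      by (rule Ints_diff)
    moreover have "1 / real (Suc m * (n choose Suc m)) =
        1 / real (m * ((n - 1) choose m)) - 1 / real (m * (n choose m))"
      by (rule Leibniz_triangle) (use Suc.prems False in auto)
    then have "real D * (1 / real (Suc m * (n choose Suc m))) =
        real D * (1 / real (m * ((n - 1) choose m)) - 1 / real (m * (n choose m)))"
      by (rule arg_cong)
    ultimately show ?thesis unfolding right_diff_distrib by (simp del: of_nat_mult binomial_Suc_Suc)
  qed
qed simp

text \<open>The central entry suffices: \<open>m * ((2 * m) choose m)\<close> divides
  \<open>D > 0\<close>, and its factor \<open>m\<close> cancels the one in the bound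
  \<open>4 ^ m / (2 * m)\<close> for the central binomial coefficient. This gives
  \<open>4 ^ m \<le> 2 * D\<close>; rounding \<open>n\<close> down to an even number costs the other
  factor 2.\<close>

lemma common_multiple_lower_bound:
  fixes D :: nat
  assumes D: "\<And>i. 1 \<le> i \<Longrightarrow> i \<le> n \<Longrightarrow> i dvd D" and "D > 0"
  shows "2 ^ n \<le> 4 * D"
proof -
  define m where "m = n div 2"
  show ?thesis
  proof (cases "m = 0")
    case True
    then have "n \<le> 1" unfolding m_def by auto
    then have "n = 0 \<or> n = 1" by auto
    then show ?thesis using \<open>D > 0\<close> by auto
  next
    case False
    have "real D / real (m * ((2 * m) choose m)) \<in> \<int>"
      using binomial_dvd_common_multiple[of "2 * m" D m] D False unfolding m_def by auto
    then obtain z where z: "real D / real (m * ((2 * m) choose m)) = of_int z" by (elim Ints_cases)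
    have pos: "real (m * ((2 * m) choose m)) > 0" using False by (simp add: zero_less_binomial_iff)
    have "of_int z > (0::real)" using z pos \<open>D > 0\<close> by (metis divide_pos_pos of_nat_0_less_iff)
    then have "of_int z \<ge> (1::real)" by simp
    then have "real (m * ((2 * m) choose m)) \<le> real D" using z pos by (metis le_divide_eq_1_pos)
    then have le: "m * ((2 * m) choose m) \<le> D" by linarith
    have "(4::real) ^ m / (2 * real m) \<le> real ((2 * m) choose m)"
      by (rule central_binomial_lower_bound) (use False in simp)
    then have "(4::real) ^ m \<le> real (2 * (m * ((2 * m) choose m)))" using False by (simp add: field_simps)
    then have "4 ^ m \<le> 2 * (m * ((2 * m) choose m))" by (metis of_nat_le_iff of_nat_power of_nat_numeral)
    then have "4 ^ m \<le> 2 * D" using le by linarith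
    moreover have "(2::nat) ^ n \<le> 2 * 4 ^ m"
    proof -
      have "n \<le> 1 + 2 * m" unfolding m_def by linarith
      then have "(2::nat) ^ n \<le> 2 ^ (1 + 2 * m)" by (intro power_increasing) auto
      then show ?thesis by (simp add: power_mult)
    qed
    ultimately show ?thesis by linarith
  qed
qed

lemma prod_le_power_card:
  fixes f :: "'a \<Rightarrow> nat"
  assumes "finite S" "\<And>x. x \<in> S \<Longrightarrow> f x \<le> b"
  shows "prod f S \<le> b ^ card S"
  using prod_mono[of S f "\<lambda>_. b"] assms by simp

text \<open>If no \<open>q < B\<close> separated \<open>S\<close>, then the product of all differences in \<open>S\<close> would be a common multiple of
  \<open>1, \<dots>, B - 1\<close>, but it has only \<open>O(k\<^sup>2 L)\<close> bits.\<close>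

lemma separating_modulus:
  assumes "finite S" "card S \<le> 2 * k" "S \<subseteq> {..<2 ^ L}" "4 * k\<^sup>2 * L + 3 < B"
  shows "\<exists>q>0. q < B \<and> inj_on (\<lambda>i. i mod q) S"
proof (rule ccontr)
  assume neg: "\<not> ?thesis"
  define T where "T = {(i, j). i \<in> S \<and> j \<in> S \<and> i < j}"
  define D where "D = (\<Prod>(i, j)\<in>T. j - i)"
  have T_sub: "T \<subseteq> S \<times> S" by (auto simp: T_def)
  then have fT: "finite T" using assms(1) finite_subset by blast
  have "card T \<le> card (S \<times> S)" using T_sub assms(1) by (intro card_mono) auto
  also have "\<dots> \<le> (2 * k) * (2 * k)" unfolding card_cartesian_product using assms(2) by (intro mult_mono) auto
  finally have cT: "card T \<le> 4 * k\<^sup>2" by (simp add: power2_eq_square)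
  have "i dvd D" if "1 \<le> i" "i \<le> B - 1" for i
  proof -
    have "i < B" using that by linarith
    then have "\<not> inj_on (\<lambda>j. j mod i) S" using neg \<open>1 \<le> i\<close> by auto
    then obtain x y where "x \<in> S" "y \<in> S" "x mod i = y mod i" "x \<noteq> y" unfolding inj_on_def by blast
    then obtain x y where xy: "x \<in> S" "y \<in> S" "x mod i = y mod i" "x < y"
      by (metis linorder_neqE_nat)
    then have "(x, y) \<in> T" by (simp add: T_def)
    then have "(y - x) dvd D" unfolding D_def using fT by (metis (mono_tags, lifting) case_prod_conv dvd_prodI)
    moreover have "i dvd y - x" using xy by (metis mod_eq_dvd_iff_nat less_imp_le)
    ultimately show ?thesis by (rule dvd_trans[rotated])
  qed
  moreover have "D > 0" unfolding D_def by (rule prod_pos) (auto simp: T_def)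
  ultimately have "2 ^ (B - 1) \<le> 4 * D" by (rule common_multiple_lower_bound)
  also have "D \<le> (2 ^ L) ^ card T" unfolding D_def
  proof (rule prod_le_power_card[OF fT])
    fix x assume "x \<in> T"
    then have "snd x < 2 ^ L" using assms(3) by (auto simp: T_def)
    then show "(case x of (i, j) \<Rightarrow> j - i) \<le> 2 ^ L" by (auto split: prod.split)
  qed
  also have "\<dots> \<le> (2 ^ L) ^ (4 * k\<^sup>2)" using cT by (intro power_increasing) auto
  also have "\<dots> = 2 ^ (4 * k\<^sup>2 * L)" by (metis mult.commute power_mult)
  \<comment> \<open>The factor 4 in front of \<open>D\<close> is worth two bits; together with the 1
    in \<open>B - 1\<close> it explains the \<open>+ 3\<close> in the hypothesis.\<close>
  finally have "(2::nat) ^ (B - 1) \<le> 2 ^ (4 * k\<^sup>2 * L + 2)" by simp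
  then have "B - 1 \<le> 4 * k\<^sup>2 * L + 2" by (metis one_less_numeral_iff power_le_imp_le_exp semiring_norm(76))
  with assms(4) show False by linarith
qed

section \<open>Coloured walks and trails\<close>

text \<open>Walks are lists of positions in the edge list, since colours are residues of
  positions.\<close>

definition iwalk :: "(nat \<times> nat) list \<Rightarrow> nat \<Rightarrow> nat \<Rightarrow> nat list \<Rightarrow> bool" where
  "iwalk es a b is \<longleftrightarrow> is_walk (set es) a b (map ((!) es) is) \<and> set is \<subseteq> {..<length es}"

lemma is_walk_append: "is_walk E a b (p @ r) \<longleftrightarrow> (\<exists>c. is_walk E a c p \<and> is_walk E c b r)"
  by (induction p arbitrary: a) auto

lemma is_walk_edges: "is_walk E a b p \<Longrightarrow> set p \<subseteq> E"
  by (induction p arbitrary: a) auto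

lemma iwalk_Nil [simp]: "iwalk es a b [] \<longleftrightarrow> a = b"
  by (simp add: iwalk_def)

lemma iwalk_Cons [simp]:
  "iwalk es a b (i # is) \<longleftrightarrow> i < length es \<and> fst (es ! i) = a \<and> iwalk es (snd (es ! i)) b is"
  by (auto simp: iwalk_def)

lemma iwalk_append: "iwalk es a b (is @ js) \<longleftrightarrow> (\<exists>c. iwalk es a c is \<and> iwalk es c b js)"
  by (auto simp: iwalk_def is_walk_append)

lemma iwalk_bounded: "iwalk es a b is \<Longrightarrow> set is \<subseteq> {..<length es}"
  by (simp add: iwalk_def)

lemma iwalk_exists_distinct:
  "iwalk es a b is \<Longrightarrow> \<exists>js. iwalk es a b js \<and> distinct js \<and> set js \<subseteq> set is \<and> length js \<le> length is"
proof (induction "length is" arbitrary: "is" rule: less_induct)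
  case less
  show ?case
  proof (cases "distinct is")
    case False
    then obtain xs ys zs y where dec: "is = xs @ [y] @ ys @ [y] @ zs" using not_distinct_decomp by blast
    have "iwalk es a b (xs @ [y] @ zs)"
      using less.prems unfolding dec by (auto simp: iwalk_append)
    with less.hyps[of "xs @ [y] @ zs"] obtain js where
      "iwalk es a b js" "distinct js" "set js \<subseteq> set (xs @ [y] @ zs)" "length js \<le> length (xs @ [y] @ zs)"
      unfolding dec by auto
    then show ?thesis unfolding dec by (intro exI[of _ js]) auto
  qed (use less.prems in blast)
qed

lemma trail_iff_iwalk:
  assumes "distinct es"
  shows "(\<exists>p. is_trail (set es) a b p \<and> length p = l) \<longleftrightarrow> (\<exists>is. iwalk es a b is \<and> distinct is \<and> length is = l)"
proof
  assume "\<exists>p. is_trail (set es) a b p \<and> length p = l"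
  then obtain p where p: "is_walk (set es) a b p" "distinct p" "length p = l" by (auto simp: is_trail_def)
  have "\<forall>e\<in>set p. \<exists>i<length es. es ! i = e" using is_walk_edges[OF p(1)] by (auto simp: in_set_conv_nth)
  then obtain g where g: "\<forall>e\<in>set p. g e < length es \<and> es ! g e = e" by metis
  then have m: "map ((!) es) (map g p) = p" by (simp add: map_idI)
  then have "distinct (map g p)" using p(2) by (metis distinct_map)
  moreover have "iwalk es a b (map g p)" using p(1) m g by (auto simp: iwalk_def)
  ultimately show "\<exists>is. iwalk es a b is \<and> distinct is \<and> length is = l" using p(3) by (metis length_map)
next
  assume "\<exists>is. iwalk es a b is \<and> distinct is \<and> length is = l"
  then obtain "is" where i: "iwalk es a b is" "distinct is" "length is = l" by blast
  have "inj_on ((!) es) (set is)" using assms iwalk_bounded[OF i(1)]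
    by (auto intro!: inj_on_nth)
  then have "distinct (map ((!) es) is)" using i(2) by (simp add: distinct_map)
  then show "\<exists>p. is_trail (set es) a b p \<and> length p = l"
    using i unfolding is_trail_def iwalk_def by (metis length_map)
qed

definition coloured :: "nat \<Rightarrow> (nat \<Rightarrow> nat) \<Rightarrow> nat list \<Rightarrow> bool" where
  "coloured q c is \<longleftrightarrow> (\<forall>h<length is. is ! h mod q = c h)"

definition solution :: "(nat \<times> nat) list \<Rightarrow> nat \<Rightarrow> nat \<Rightarrow> nat \<Rightarrow> nat \<Rightarrow> bool" where
  "solution es s t K1 K2 \<longleftrightarrow> (\<exists>is. iwalk es s t is \<and> distinct is \<and> K1 \<le> length is \<and> length is \<le> K1 + K2)"

definition witness :: "(nat \<times> nat) list \<Rightarrow> nat \<Rightarrow> nat \<Rightarrow> nat \<Rightarrow> nat \<Rightarrow> nat \<Rightarrow> nat list \<Rightarrow> bool" where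
  "witness es t K1 K2 s v is \<longleftrightarrow> iwalk es s v is \<and> length is = K1 \<and> distinct is \<and>
     (\<exists>js. iwalk es v t js \<and> length js \<le> K2 \<and> set js \<inter> set is = {})"

text \<open>The first part has \<open>K1\<close> edges already, so the second part may be shortened
  to a trail without violating the lower bound.\<close>

lemma witness_solution:
  assumes "witness es t K1 K2 s v is"
  shows "solution es s t K1 K2"
proof -
  obtain js where i: "iwalk es s v is" "length is = K1" "distinct is"
    and j: "iwalk es v t js" "length js \<le> K2" "set js \<inter> set is = {}"
    using assms unfolding witness_def by blast
  obtain js' where "iwalk es v t js'" "distinct js'" "set js' \<subseteq> set js" "length js' \<le> length js"
    using iwalk_exists_distinct[OF j(1)] by blast
  then show ?thesis unfolding solution_def using i j
    by (intro exI[of _ "is @ js'"]) (auto simp: iwalk_append)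
qed

text \<open>The universal part allows a search to return any walk with these colours; the
  existential part guarantees that it finds one.\<close>

definition good :: "(nat \<times> nat) list \<Rightarrow> nat \<Rightarrow> nat \<Rightarrow> nat \<Rightarrow> nat \<Rightarrow> nat \<Rightarrow> nat \<Rightarrow> (nat \<Rightarrow> nat) \<Rightarrow> bool" where
  "good es s t K1 K2 v q c \<longleftrightarrow>
     (\<exists>is. iwalk es s v is \<and> length is = K1 \<and> coloured q c is) \<and>
     (\<forall>is. iwalk es s v is \<longrightarrow> length is = K1 \<longrightarrow> coloured q c is \<longrightarrow> witness es t K1 K2 s v is)"

text \<open>Take a shortest solution \<open>rs\<close> and colours that separate its first \<open>K1\<close> from its last \<open>K1\<close> edges.
  If some walk with the colours of the prefix met the rest of \<open>rs\<close>, then switching to \<open>rs\<close> at the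
  first meeting edge would give a shorter trail that still contains the last \<open>K1\<close> edges.\<close>

lemma solution_good:
  assumes sol: "solution es s t K1 K2" and L: "length es \<le> 2 ^ L" and B: "4 * K1\<^sup>2 * L + 3 < B"
    and V: "set es \<subseteq> {..<n} \<times> {..<n}" "s < n"
  shows "\<exists>v q c. v < n \<and> q < B \<and> (\<forall>h<K1. c h < B) \<and> good es s t K1 K2 v q c"
proof -
  let ?S = "\<lambda>rs. iwalk es s t rs \<and> distinct rs \<and> K1 \<le> length rs \<and> length rs \<le> K1 + K2"
  obtain rs where rs: "?S rs" and min: "\<And>rs'. ?S rs' \<Longrightarrow> length rs \<le> length rs'"
    using sol arg_min_nat_lemma[of ?S _ length] unfolding solution_def by (metis (no_types, lifting))
  define is0 where "is0 = take K1 rs"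
  define js0 where "js0 = drop K1 rs"
  \<comment> \<open>By truncated subtraction, \<open>ts\<close> is all of \<open>js0\<close> if
    fewer than \<open>K1\<close> edges follow the prefix.\<close>
  define ts where "ts = drop (length js0 - K1) js0"
  have split: "rs = is0 @ js0" by (simp add: is0_def js0_def)
  have l0: "length is0 = K1" using rs by (simp add: is0_def)
  have ts_sub: "set ts \<subseteq> set js0" by (simp add: ts_def set_drop_subset)
  obtain v where v: "iwalk es s v is0" "iwalk es v t js0" using rs split iwalk_append by metis
  have disj: "set is0 \<inter> set js0 = {}" "distinct is0" "distinct js0" using rs split by auto
  define S where "S = set is0 \<union> set ts"
  have "card S \<le> card (set is0) + card (set ts)" unfolding S_def by (rule card_Un_le)
  also have "\<dots> \<le> K1 + K1" using card_length[of is0] card_length[of ts] l0 by (intro add_mono) (auto simp: ts_def)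
  finally have cS: "card S \<le> 2 * K1" by simp
  have "S \<subseteq> {..<length es}" using rs split ts_sub iwalk_bounded[of es s t rs] unfolding S_def by auto
  then have "S \<subseteq> {..<2 ^ L}" using L by auto
  then obtain q where q: "0 < q" "q < B" "inj_on (\<lambda>i. i mod q) S"
    using separating_modulus[OF _ cS _ B] by (auto simp: S_def)
  define c where "c h = is0 ! h mod q" for h
  have vn: "v < n"
  proof (cases "is0 = []")
    case True
    then show ?thesis using v V by auto
  next
    case False
    then obtain xs x where x: "is0 = xs @ [x]" by (metis append_butlast_last_id)
    then have "v = snd (es ! x)" "x < length es" using v(1) by (auto simp: iwalk_append)
    then show ?thesis using V(1) by (metis mem_Sigma_iff lessThan_iff nth_mem prod.collapse subsetD)
  qed
  have col: "witness es t K1 K2 s v is" if w: "iwalk es s v is" "length is = K1" "coloured q c is" for "is"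
  proof -
    have same: "is ! h mod q = is0 ! h mod q" if "h < K1" for h
      using w(2,3) that by (simp add: coloured_def c_def)
    have in_S: "is0 ! h \<in> S" if "h < K1" for h using that l0 by (simp add: S_def)
    \<comment> \<open>The edges of \<open>is0\<close> have pairwise different colours, and
      \<open>is\<close> repeats these colours position by position.\<close>
    have dis: "distinct is"
    proof (unfold distinct_conv_nth, intro allI impI)
      fix i j assume ij: "i < length is" "j < length is" "i \<noteq> j"
      then have "is0 ! i \<noteq> is0 ! j" using disj(2) w(2) l0 by (simp add: nth_eq_iff_index_eq)
      then have "is0 ! i mod q \<noteq> is0 ! j mod q"
        using q(3) in_S[of i] in_S[of j] ij w(2) by (metis inj_on_def)
      then show "is ! i \<noteq> is ! j" using same[of i] same[of j] ij w(2) by metis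
    qed
    \<comment> \<open>An edge of \<open>ts\<close> with the colour of \<open>is0 ! h\<close> would
      be \<open>is0 ! h\<close> itself, by injectivity on \<open>S\<close>.\<close>
    have ts: "is ! h \<notin> set ts" if h: "h < K1" for h
    proof
      assume a: "is ! h \<in> set ts"
      then have "is ! h \<in> S" by (simp add: S_def)
      then have "is ! h = is0 ! h" by (rule inj_onD[OF q(3) same[OF h] _ in_S[OF h]])
      moreover have "is0 ! h \<in> set is0" using h l0 by simp
      ultimately show False using a ts_sub disj(1) by auto
    qed
    have "set is \<inter> set js0 = {}"
    proof (rule ccontr)
      assume "set is \<inter> set js0 \<noteq> {}"
      then have "\<exists>x\<in>set is. x \<in> set js0" by auto
      \<comment> \<open>Since \<open>e\<close> is the first meeting edge, \<open>xs\<close> shares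
        nothing with \<open>js0\<close>, which keeps the exchanged trail distinct.\<close>
      then obtain xs e xs' where e: "is = xs @ e # xs'" "e \<in> set js0" "\<forall>y\<in>set xs. y \<notin> set js0"
        by (rule split_list_first_propE)
      obtain ys zs where js0: "js0 = ys @ e # zs" using split_list[OF e(2)] by blast
      have "e = is ! length xs" "length xs < K1" using e(1) w(2) by auto
      then have nts: "e \<notin> set ts" using ts by metis
      \<comment> \<open>As \<open>e\<close> is not in \<open>ts\<close>, it comes before the last
        \<open>K1\<close> edges of \<open>js0\<close>, so the rest after it alone satisfies the
        lower bound.\<close>
      have K1: "K1 \<le> length zs"
      proof (rule ccontr)
        assume "\<not> K1 \<le> length zs"
        then have "length js0 - K1 \<le> length ys" by (simp add: js0)
        then have "e \<in> set ts" unfolding ts_def js0 by simp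
        with nts show False ..
      qed
      have "iwalk es s t (xs @ e # zs)"
        using w(1) v(2) unfolding e(1) js0 by (auto simp: iwalk_append)
      moreover have "distinct (xs @ e # zs)" using dis disj(3) e(2,3) unfolding e(1) js0 by auto
      \<comment> \<open>Fewer than \<open>K1\<close> edges replace the \<open>K1\<close> edges of
        \<open>is0\<close>.\<close>
      moreover have "length (xs @ e # zs) < length rs"
        using \<open>length xs < K1\<close> l0 unfolding split js0 by simp
      ultimately show False using min[of "xs @ e # zs"] K1 rs by auto
    qed
    then show ?thesis unfolding witness_def using w(1,2) dis v(2) rs
      by (intro conjI exI[of _ js0]) (auto simp: js0_def)
  qed
  have "coloured q c is0" by (simp add: coloured_def c_def)
  then have "good es s t K1 K2 v q c" unfolding good_def using v(1) l0 col by blast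
  moreover have "\<forall>h<K1. c h < B" using q(1,2) by (auto simp: c_def intro: less_trans[OF mod_less_divisor])
  ultimately show ?thesis using vn q(2) by blast
qed

section \<open>Guesses as numbers in mixed radix\<close>

lemma exists_digits:
  fixes c :: "nat \<Rightarrow> nat"
  assumes "\<forall>h<k. c h < B"
  shows "\<exists>N < B ^ k. \<forall>h<k. N div B ^ h mod B = c h"
  using assms
proof (induction k arbitrary: c)
  case (Suc k)
  from Suc.IH[of "c \<circ> Suc"] Suc.prems obtain N where
    N: "N < B ^ k" "\<forall>h<k. N div B ^ h mod B = c (Suc h)" by auto
  have c0: "c 0 < B" using Suc.prems by auto
  have d: "(c 0 + B * N) div B = N" using c0 by simp
  have "c 0 + B * N < B ^ Suc k"
  proof -
    have "c 0 + B * N < B * Suc N" using c0 by simp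
    also have "\<dots> \<le> B * B ^ k" using N(1) by (intro mult_le_mono2) simp
    finally show ?thesis by simp
  qed
  moreover have "\<forall>h<Suc k. (c 0 + B * N) div B ^ h mod B = c h"
  proof (intro allI impI)
    fix h assume "h < Suc k"
    then show "(c 0 + B * N) div B ^ h mod B = c h"
      using c0 d N(2) by (cases h) (simp_all add: div_mult2_eq)
  qed
  ultimately show ?case by blast
qed simp

text \<open>The least significant digit has base \<open>n\<close>, all others base \<open>B\<close>:
  one counter enumerates all guesses, and repeated division decodes them.\<close>

definition good_number :: "(nat \<times> nat) list \<Rightarrow> nat \<Rightarrow> nat \<Rightarrow> nat \<Rightarrow> nat \<Rightarrow> nat \<Rightarrow> nat \<Rightarrow> nat \<Rightarrow> bool" where
  "good_number es n s t K1 K2 B N \<longleftrightarrow>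
     good es s t K1 K2 (N mod n) (N div n mod B) (\<lambda>h. N div n div B div B ^ h mod B)"

lemma solution_good_number:
  assumes "solution es s t K1 K2" "length es \<le> 2 ^ L" "4 * K1\<^sup>2 * L + 3 < B"
    "set es \<subseteq> {..<n} \<times> {..<n}" "s < n"
  shows "\<exists>N < n * B ^ Suc K1. good_number es n s t K1 K2 B N"
proof -
  obtain v q c where g: "v < n" "q < B" "\<forall>h<K1. c h < B" "good es s t K1 K2 v q c"
    using solution_good[OF assms] by blast
  obtain N where N: "N < B ^ K1" "\<forall>h<K1. N div B ^ h mod B = c h"
    using exists_digits[OF g(3)] by blast
  define M where "M = v + n * (q + B * N)"
  have M: "M mod n = v" "M div n = q + B * N" "(q + B * N) mod B = q" "(q + B * N) div B = N"
    using g(1,2) by (simp_all add: M_def)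
  have "q + B * N < B * Suc N" using g(2) by simp
  also have "\<dots> \<le> B ^ Suc K1" using N(1) by (simp only: power_Suc Suc_leI mult_le_mono2)
  finally have "q + B * N < B ^ Suc K1" .
  then have "v + n * (q + B * N) < n * B ^ Suc K1"
    using g(1) by (metis (no_types, lifting) Suc_leI add_less_cancel_right less_le_trans mult_Suc_right mult_le_mono2)
  \<comment> \<open>The decoded colours agree with \<open>c\<close> only below \<open>K1\<close>;
    \<open>conj_cong\<close> supplies \<open>length is = K1\<close> where the colours are
    compared.\<close>
  moreover have "good_number es n s t K1 K2 B M"
    using g(4) N(2) unfolding good_number_def M good_def coloured_def by (auto cong: conj_cong)
  ultimately show ?thesis unfolding M_def by blast
qed

section \<open>A while language for the RAM\<close>

type_synonym vars = "nat \<Rightarrow> nat"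

datatype arr = AR | AP | AU

type_synonym arrs = "arr \<Rightarrow> nat \<Rightarrow> nat"

datatype com =
    Skip
  | Const nat nat
  | Add nat nat nat
  | Sub nat nat nat
  | Get nat arr nat
  | Put arr nat nat
  | Read nat nat
  | Seq com com  (infixr ";;" 60)
  | Cond nat com com
  | While nat com

text \<open>The step counts are exactly those of the compiled code: an array access needs four
  instructions for the address and one for the access, and an unconditional jump needs two, since it
  is a test of a cell that was just zeroed.\<close>

inductive bigstep :: "nat list \<Rightarrow> com \<Rightarrow> vars \<Rightarrow> arrs \<Rightarrow> nat \<Rightarrow> vars \<Rightarrow> arrs \<Rightarrow> bool"
  for inp where
  Skip: "bigstep inp Skip v A 0 v A"
| Const: "bigstep inp (Const x c) v A 1 (v(x := c)) A"
| Add: "bigstep inp (Add x y z) v A 1 (v(x := v y + v z)) A"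
| Sub: "bigstep inp (Sub x y z) v A 1 (v(x := v y - v z)) A"
| Get: "bigstep inp (Get x a y) v A 5 (v(x := A a (v y))) A"
| Put: "bigstep inp (Put a x y) v A 5 v (A(a := (A a)(v x := v y)))"
| Read: "bigstep inp (Read x y) v A 1 (v(x := read_input inp (v y))) A"
| Seq: "bigstep inp c1 v A d1 v1 A1 \<Longrightarrow> bigstep inp c2 v1 A1 d2 v2 A2
    \<Longrightarrow> bigstep inp (c1 ;; c2) v A (d1 + d2) v2 A2"
| CondT: "v x \<noteq> 0 \<Longrightarrow> bigstep inp c1 v A d v' A' \<Longrightarrow> bigstep inp (Cond x c1 c2) v A (1 + d + 2) v' A'"
| CondF: "v x = 0 \<Longrightarrow> bigstep inp c2 v A d v' A' \<Longrightarrow> bigstep inp (Cond x c1 c2) v A (1 + d) v' A'"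
| WhileT: "v x \<noteq> 0 \<Longrightarrow> bigstep inp c v A d1 v1 A1 \<Longrightarrow> bigstep inp (While x c) v1 A1 d2 v2 A2
    \<Longrightarrow> bigstep inp (While x c) v A (1 + d1 + 2 + d2) v2 A2"
| WhileF: "v x = 0 \<Longrightarrow> bigstep inp (While x c) v A 1 v A"

section \<open>Weakest preconditions with a clock\<close>

inductive_cases SkipE: "bigstep inp Skip v A d v' A'"
inductive_cases ConstE: "bigstep inp (Const x c) v A d v' A'"
inductive_cases AddE: "bigstep inp (Add x y z) v A d v' A'"
inductive_cases SubE: "bigstep inp (Sub x y z) v A d v' A'"
inductive_cases GetE: "bigstep inp (Get x a y) v A d v' A'"
inductive_cases PutE: "bigstep inp (Put a x y) v A d v' A'"
inductive_cases ReadE: "bigstep inp (Read x y) v A d v' A'"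
inductive_cases SeqE: "bigstep inp (c1 ;; c2) v A d v' A'"
inductive_cases CondE: "bigstep inp (Cond x c1 c2) v A d v' A'"

text \<open>A terminating run is demanded, so this is total correctness. Passing the elapsed time
  \<open>t\<close> along turns time bounds into ordinary conjuncts of invariants.\<close>

definition wp :: "nat list \<Rightarrow> com \<Rightarrow> (vars \<Rightarrow> arrs \<Rightarrow> nat \<Rightarrow> bool) \<Rightarrow> vars \<Rightarrow> arrs \<Rightarrow> nat \<Rightarrow> bool" where
  "wp inp c Q v A t \<longleftrightarrow> (\<exists>v' A' d. bigstep inp c v A d v' A' \<and> Q v' A' (t + d))"

lemma wp_Skip: "wp inp Skip Q v A t \<longleftrightarrow> Q v A t"
  unfolding wp_def by (metis SkipE add.right_neutral bigstep.Skip)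

lemma wp_Const: "wp inp (Const x c) Q v A t \<longleftrightarrow> Q (v(x := c)) A (t + 1)"
  unfolding wp_def by (metis ConstE bigstep.Const)

lemma wp_Add: "wp inp (Add x y z) Q v A t \<longleftrightarrow> Q (v(x := v y + v z)) A (t + 1)"
  unfolding wp_def by (metis AddE bigstep.Add)

lemma wp_Sub: "wp inp (Sub x y z) Q v A t \<longleftrightarrow> Q (v(x := v y - v z)) A (t + 1)"
  unfolding wp_def by (metis SubE bigstep.Sub)

lemma wp_Get: "wp inp (Get x a y) Q v A t \<longleftrightarrow> Q (v(x := A a (v y))) A (t + 5)"
  unfolding wp_def by (metis GetE bigstep.Get)

lemma wp_Put: "wp inp (Put a x y) Q v A t \<longleftrightarrow> Q v (A(a := (A a)(v x := v y))) (t + 5)"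
  unfolding wp_def by (metis PutE bigstep.Put)

lemma wp_Read: "wp inp (Read x y) Q v A t \<longleftrightarrow> Q (v(x := read_input inp (v y))) A (t + 1)"
  unfolding wp_def by (metis ReadE bigstep.Read)

lemma wp_Seq: "wp inp (c1 ;; c2) Q v A t \<longleftrightarrow> wp inp c1 (wp inp c2 Q) v A t"
proof
  assume "wp inp (c1 ;; c2) Q v A t"
  then show "wp inp c1 (wp inp c2 Q) v A t"
    unfolding wp_def by (elim exE conjE SeqE) (metis add.assoc)
next
  assume "wp inp c1 (wp inp c2 Q) v A t"
  then show "wp inp (c1 ;; c2) Q v A t"
    unfolding wp_def by (metis add.assoc bigstep.Seq)
qed

lemma wp_Cond: "wp inp (Cond x c1 c2) Q v A t \<longleftrightarrow>
  (if v x \<noteq> 0 then wp inp c1 (\<lambda>v A t. Q v A (t + 2)) v A (t + 1) else wp inp c2 Q v A (t + 1))"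
proof
  assume "wp inp (Cond x c1 c2) Q v A t"
  then show "if v x \<noteq> 0 then wp inp c1 (\<lambda>v A t. Q v A (t + 2)) v A (t + 1) else wp inp c2 Q v A (t + 1)"
    unfolding wp_def by (elim exE conjE CondE) (auto simp: add.assoc)
next
  assume a: "if v x \<noteq> 0 then wp inp c1 (\<lambda>v A t. Q v A (t + 2)) v A (t + 1) else wp inp c2 Q v A (t + 1)"
  show "wp inp (Cond x c1 c2) Q v A t"
  proof (cases "v x = 0")
    case True
    then obtain v' A' d where "bigstep inp c2 v A d v' A'" "Q v' A' (t + 1 + d)"
      using a unfolding wp_def by auto
    moreover have "bigstep inp (Cond x c1 c2) v A (1 + d) v' A'"
      by (rule bigstep.CondF) fact+
    ultimately show ?thesis unfolding wp_def by (metis add.assoc)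
  next
    case False
    then obtain v' A' d where "bigstep inp c1 v A d v' A'" "Q v' A' (t + 1 + d + 2)"
      using a unfolding wp_def by auto
    moreover have "bigstep inp (Cond x c1 c2) v A (1 + d + 2) v' A'"
      by (rule bigstep.CondT) fact+
    ultimately show ?thesis unfolding wp_def by (metis add.assoc)
  qed
qed

lemmas wp_simps = wp_Skip wp_Const wp_Add wp_Sub wp_Get wp_Put wp_Read wp_Seq wp_Cond

text \<open>The number \<open>n\<close> of iterations is given in advance and indexes the invariant,
  which replaces a termination measure. The 1 pays for the test and the 2 for the jump back.\<close>

lemma wp_While:
  assumes "I 0 v A t"
    and step: "\<And>i v A t. i < n \<Longrightarrow> I i v A t \<Longrightarrow> v x \<noteq> 0 \<and> wp inp c (\<lambda>v A t. I (Suc i) v A (t + 2)) v A (t + 1)"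
    and fin: "\<And>v A t. I n v A t \<Longrightarrow> v x = 0 \<and> Q v A (t + 1)"
  shows "wp inp (While x c) Q v A t"
proof -
  have "I i v A t \<Longrightarrow> i \<le> n \<Longrightarrow> wp inp (While x c) Q v A t" for i v A t
  proof (induction "n - i" arbitrary: i v A t)
    case 0
    then have "v x = 0" "Q v A (t + 1)" using fin[of v A t] by auto
    then show ?case using bigstep.WhileF[of v x inp c A] unfolding wp_def by blast
  next
    case (Suc k)
    then have "i < n" by simp
    with step Suc.prems obtain v1 A1 d1 where 1: "v x \<noteq> 0" "bigstep inp c v A d1 v1 A1"
      "I (Suc i) v1 A1 (t + 1 + d1 + 2)"
      unfolding wp_def by blast
    have "wp inp (While x c) Q v1 A1 (t + 1 + d1 + 2)"
      using Suc.hyps(1)[OF _ 1(3)] Suc.hyps(2) \<open>i < n\<close> by simp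
    then obtain v2 A2 d2 where 2: "bigstep inp (While x c) v1 A1 d2 v2 A2" "Q v2 A2 (t + 1 + d1 + 2 + d2)"
      unfolding wp_def by blast
    show ?case unfolding wp_def
      using bigstep.WhileT[of v x, OF 1(1,2) 2(1)] 2(2) by (metis add.assoc)
  qed
  then show ?thesis using assms(1) by blast
qed

section \<open>Compilation to RAM code\<close>

text \<open>Register \<open>x\<close> lives at address \<open>4 * x + 11\<close>, entry \<open>i\<close> of an array at \<open>4 * i + aoff a\<close>; cells 3 and 7
  are scratch space of the compiler, and cell 0 receives the output.\<close>

definition raddr :: "nat \<Rightarrow> nat" where
  "raddr x = 4 * x + 11"

fun aoff :: "arr \<Rightarrow> nat" where
  "aoff AR = 0" | "aoff AP = 1" | "aoff AU = 2"

text \<open>Two doublings replace the multiplication by 4, because the machine can only add and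
  subtract. The address ends up in cell 3.\<close>

definition acode :: "arr \<Rightarrow> nat \<Rightarrow> instr list" where
  "acode a y = [ADD 3 (raddr y) (raddr y), ADD 3 3 3, LOADC 7 (aoff a), ADD 3 3 7]"

text \<open>Jump targets are absolute, so the code depends on its start address
  \<open>i\<close>.\<close>

fun comp :: "nat \<Rightarrow> com \<Rightarrow> instr list" where
  "comp i Skip = []"
| "comp i (Const x c) = [LOADC (raddr x) c]"
| "comp i (Add x y z) = [ADD (raddr x) (raddr y) (raddr z)]"
| "comp i (Sub x y z) = [SUB (raddr x) (raddr y) (raddr z)]"
| "comp i (Get x a y) = acode a y @ [LOADI (raddr x) 3]"
| "comp i (Put a x y) = acode a x @ [STOREI 3 (raddr y)]"
| "comp i (Read x y) = [READ (raddr x) (raddr y)]"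
| "comp i (c1 ;; c2) = comp i c1 @ comp (i + length (comp i c1)) c2"
| "comp i (Cond x c1 c2) =
    (let p1 = comp (i + 1) c1; j = i + 1 + length p1 + 2; p2 = comp j c2
     in [JZ (raddr x) j] @ p1 @ [LOADC 3 0, JZ 3 (j + length p2)] @ p2)"
| "comp i (While x c) =
    (let p = comp (i + 1) c in [JZ (raddr x) (i + 1 + length p + 2)] @ p @ [LOADC 3 0, JZ 3 i])"

primrec code_at :: "instr list \<Rightarrow> nat \<Rightarrow> instr list \<Rightarrow> bool" where
  "code_at P i [] \<longleftrightarrow> True"
| "code_at P i (x # xs) \<longleftrightarrow> i < length P \<and> P ! i = x \<and> code_at P (Suc i) xs"

lemma code_at_append: "code_at P i (xs @ ys) \<longleftrightarrow> code_at P i xs \<and> code_at P (i + length xs) ys"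
  by (induction xs arbitrary: i) auto

lemma code_at_self: "code_at (xs @ ys @ zs) (length xs) ys"
proof (induction ys arbitrary: xs)
  case (Cons y ys)
  have "code_at ((xs @ [y]) @ ys @ zs) (length (xs @ [y])) ys" by (rule Cons)
  then show ?case by (simp add: nth_append)
qed simp

definition represents :: "(nat \<Rightarrow> nat) \<Rightarrow> vars \<Rightarrow> arrs \<Rightarrow> bool" where
  "represents m v A \<longleftrightarrow> (\<forall>x. m (raddr x) = v x) \<and> (\<forall>a i. m (4 * i + aoff a) = A a i)"

lemma aoff_less: "aoff a < 3"
  by (cases a) simp_all

lemma aoff_inj: "aoff a = aoff b \<longleftrightarrow> a = b"
  by (cases a; cases b) simp_all

text \<open>Modulo 4, registers are 3 and array entries are 0, 1 or 2, so they never collide however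
  far the arrays grow. The scratch cells share the residue of the registers but lie below the first
  of them.\<close>

lemma aoff_neq_raddr: "4 * i + aoff a \<noteq> raddr x"
  using aoff_less[of a] unfolding raddr_def by presburger

lemma addr_inj: "4 * i + aoff a = 4 * j + aoff b \<longleftrightarrow> i = j \<and> a = b"
proof -
  have "4 * i + aoff a = 4 * j + aoff b \<longleftrightarrow> i = j \<and> aoff a = aoff b"
    using aoff_less[of a] aoff_less[of b] by presburger
  then show ?thesis by (simp add: aoff_inj)
qed

lemma raddr_inj [simp]: "raddr x = raddr y \<longleftrightarrow> x = y"
  by (simp add: raddr_def)

lemma scratch_neq: "raddr x \<noteq> 3" "raddr x \<noteq> 7" "4 * i + aoff a \<noteq> 3" "4 * i + aoff a \<noteq> 7"
  using aoff_less[of a] unfolding raddr_def by presburger+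

lemma represents_scratch:
  "represents m v A \<Longrightarrow> represents (m(3 := c)) v A" "represents m v A \<Longrightarrow> represents (m(7 := c)) v A"
  by (simp_all add: represents_def scratch_neq)

lemma represents_var: "represents m v A \<Longrightarrow> represents (m(raddr x := c)) (v(x := c)) A"
  by (simp add: represents_def aoff_neq_raddr)

lemma represents_arr:
  "represents m v A \<Longrightarrow> represents (m(4 * i + aoff a := c)) v (A(a := (A a)(i := c)))"
  by (auto simp: represents_def aoff_neq_raddr[symmetric] addr_inj)

lemma funpow_trans: "(f ^^ m) x = y \<Longrightarrow> (f ^^ n) y = z \<Longrightarrow> (f ^^ (m + n)) x = z"
  by (simp add: add.commute[of m n] funpow_add)

lemma funpow_2: "(f ^^ 2) x = f (f x)" and funpow_4: "(f ^^ 4) x = f (f (f (f x)))"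
  by (simp_all add: eval_nat_numeral)

lemma acode_run:
  assumes "code_at P i (acode a y)" "represents m v A"
  shows "\<exists>m'. (ram_step P inp ^^ 4) (i, m) = (i + 4, m') \<and> m' 3 = 4 * v y + aoff a \<and> represents m' v A"
proof -
  have y: "m (raddr y) = v y" using assms(2) by (simp add: represents_def)
  let ?m1 = "m(3 := v y + v y)"
  let ?m2 = "?m1(3 := v y + v y + (v y + v y))"
  let ?m3 = "?m2(7 := aoff a)"
  let ?m4 = "?m3(3 := v y + v y + (v y + v y) + aoff a)"
  have "(ram_step P inp ^^ 4) (i, m) = (i + 4, ?m4)"
    using assms(1) y by (simp add: acode_def ram_step_def funpow_4)
  moreover have "represents ?m4 v A" using assms(2) by (intro represents_scratch)
  ultimately show ?thesis by (intro exI[of _ ?m4]) simp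
qed

lemma goto_run:
  assumes "code_at P i [LOADC 3 0, JZ 3 j]" "represents m v A"
  shows "\<exists>m'. (ram_step P inp ^^ 2) (i, m) = (j, m') \<and> represents m' v A"
proof -
  have "(ram_step P inp ^^ 2) (i, m) = (j, m(3 := 0))"
    using assms(1) by (simp add: ram_step_def funpow_2)
  with represents_scratch(1)[OF assms(2)] show ?thesis by blast
qed

text \<open>Induction on the derivation, gluing exact step counts together. The start address and
  the memory stay general: a loop body sits at \<open>i + 1\<close>, and after it the same loop code
  at \<open>i\<close> runs again from a changed memory.\<close>

lemma comp_correct:
  "bigstep inp c v A d v' A' \<Longrightarrow> code_at P i (comp i c) \<Longrightarrow> represents m v A
   \<Longrightarrow> \<exists>m'. (ram_step P inp ^^ d) (i, m) = (i + length (comp i c), m') \<and> represents m' v' A'"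
proof (induction arbitrary: i m rule: bigstep.induct)
  case (Skip v A)
  then show ?case by auto
next
  case (Const x c v A)
  then show ?case using represents_var[of m v A x c] by (simp add: ram_step_def del: fun_upd_apply)
next
  case (Add x y z v A)
  then show ?case using represents_var[of m v A x "v y + v z"]
    by (simp add: ram_step_def represents_def[of m v] del: fun_upd_apply)
next
  case (Sub x y z v A)
  then show ?case using represents_var[of m v A x "v y - v z"]
    by (simp add: ram_step_def represents_def[of m v] del: fun_upd_apply)
next
  case (Get x a y v A)
  then have c: "code_at P i (acode a y)" "code_at P (i + 4) [LOADI (raddr x) 3]"
    by (auto simp: code_at_append acode_def eval_nat_numeral)
  from acode_run[OF c(1) Get(2)] obtain m' where
    m': "(ram_step P inp ^^ 4) (i, m) = (i + 4, m')" "m' 3 = 4 * v y + aoff a" "represents m' v A" by blast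
  have "(ram_step P inp ^^ 1) (i + 4, m') = (i + 5, m'(raddr x := A a (v y)))"
    using c(2) m'(2,3) by (simp add: ram_step_def represents_def)
  from funpow_trans[OF m'(1) this] represents_var[OF m'(3)] show ?case
    by (auto simp: acode_def simp del: fun_upd_apply)
next
  case (Put a x y v A)
  then have c: "code_at P i (acode a x)" "code_at P (i + 4) [STOREI 3 (raddr y)]"
    by (auto simp: code_at_append acode_def eval_nat_numeral)
  from acode_run[OF c(1) Put(2)] obtain m' where
    m': "(ram_step P inp ^^ 4) (i, m) = (i + 4, m')" "m' 3 = 4 * v x + aoff a" "represents m' v A" by blast
  have "(ram_step P inp ^^ 1) (i + 4, m') = (i + 5, m'(4 * v x + aoff a := v y))"
    using c(2) m'(2,3) by (simp add: ram_step_def represents_def)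
  from funpow_trans[OF m'(1) this] represents_arr[OF m'(3)] show ?case
    by (auto simp: acode_def simp del: fun_upd_apply)
next
  case (Read x y v A)
  then show ?case using represents_var[of m v A x "read_input inp (v y)"]
    by (simp add: ram_step_def represents_def[of m v] del: fun_upd_apply)
next
  case (Seq c1 v A d1 v1 A1 c2 d2 v2 A2)
  then have c: "code_at P i (comp i c1)" "code_at P (i + length (comp i c1)) (comp (i + length (comp i c1)) c2)"
    by (auto simp: code_at_append)
  from Seq.IH(1)[OF c(1) Seq.prems(2)] obtain m1 where
    m1: "(ram_step P inp ^^ d1) (i, m) = (i + length (comp i c1), m1)" "represents m1 v1 A1" by blast
  from Seq.IH(2)[OF c(2) m1(2)] obtain m2 where
    m2: "(ram_step P inp ^^ d2) (i + length (comp i c1), m1) =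
      (i + length (comp i c1) + length (comp (i + length (comp i c1)) c2), m2)" "represents m2 v2 A2" by blast
  show ?case using funpow_trans[OF m1(1) m2(1)] m2(2) by (auto simp: add.assoc)
next
  case (CondT v x c1 A d v' A' c2)
  define p1 where "p1 = comp (i + 1) c1"
  define j where "j = i + 1 + length p1 + 2"
  define p2 where "p2 = comp j c2"
  from CondT.prems have c: "code_at P i [JZ (raddr x) j]" "code_at P (i + 1) (comp (i + 1) c1)"
    "code_at P (i + 1 + length p1) [LOADC 3 0, JZ 3 (j + length p2)]"
    by (auto simp: code_at_append Let_def p1_def p2_def j_def)
  have 1: "(ram_step P inp ^^ 1) (i, m) = (i + 1, m)"
    using c(1) CondT.hyps(1) CondT.prems(2) by (simp add: ram_step_def represents_def)
  from CondT.IH[OF c(2) CondT.prems(2)] obtain m1 where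
    m1: "(ram_step P inp ^^ d) (i + 1, m) = (i + 1 + length p1, m1)" "represents m1 v' A'"
    by (auto simp: p1_def)
  from goto_run[OF c(3) m1(2)] obtain m2 where
    m2: "(ram_step P inp ^^ 2) (i + 1 + length p1, m1) = (j + length p2, m2)" "represents m2 v' A'" by blast
  show ?case using funpow_trans[OF funpow_trans[OF 1 m1(1)] m2(1)] m2(2)
    by (auto simp: Let_def p1_def p2_def j_def add.assoc)
next
  case (CondF v x c2 A d v' A' c1)
  define p1 where "p1 = comp (i + 1) c1"
  define j where "j = i + 1 + length p1 + 2"
  define p2 where "p2 = comp j c2"
  from CondF.prems have c: "code_at P i [JZ (raddr x) j]" "code_at P j (comp j c2)"
    by (auto simp: code_at_append Let_def p1_def p2_def j_def)
  have 1: "(ram_step P inp ^^ 1) (i, m) = (j, m)"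
    using c(1) CondF.hyps(1) CondF.prems(2) by (simp add: ram_step_def represents_def)
  from CondF.IH[OF c(2) CondF.prems(2)] obtain m1 where
    m1: "(ram_step P inp ^^ d) (j, m) = (j + length p2, m1)" "represents m1 v' A'"
    by (auto simp: p2_def)
  show ?case using funpow_trans[OF 1 m1(1)] m1(2)
    by (auto simp: Let_def p1_def p2_def j_def add.assoc)
next
  case (WhileT v x c A d1 v1 A1 d2 v2 A2)
  define p where "p = comp (i + 1) c"
  from WhileT.prems have c: "code_at P i [JZ (raddr x) (i + 1 + length p + 2)]" "code_at P (i + 1) (comp (i + 1) c)"
    "code_at P (i + 1 + length p) [LOADC 3 0, JZ 3 i]"
    by (auto simp: code_at_append Let_def p_def)
  have 1: "(ram_step P inp ^^ 1) (i, m) = (i + 1, m)"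
    using c(1) WhileT.hyps(1) WhileT.prems(2) by (simp add: ram_step_def represents_def)
  from WhileT.IH(1)[OF c(2) WhileT.prems(2)] obtain m1 where
    m1: "(ram_step P inp ^^ d1) (i + 1, m) = (i + 1 + length p, m1)" "represents m1 v1 A1"
    by (auto simp: p_def)
  from goto_run[OF c(3) m1(2)] obtain m2 where
    m2: "(ram_step P inp ^^ 2) (i + 1 + length p, m1) = (i, m2)" "represents m2 v1 A1" by blast
  from WhileT.IH(2)[OF WhileT.prems(1) m2(2)] obtain m3 where
    m3: "(ram_step P inp ^^ d2) (i, m2) = (i + length (comp i (While x c)), m3)" "represents m3 v2 A2" by blast
  show ?case using funpow_trans[OF funpow_trans[OF funpow_trans[OF 1 m1(1)] m2(1)] m3(1)] m3(2)
    by auto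
next
  case (WhileF v x c A)
  then show ?case by (auto simp: Let_def ram_step_def represents_def)
qed

text \<open>Cell 0 initially holds the input length but is also entry 0 of the array
  \<open>AR\<close>, so it is cleared at the start. The output overwrites this entry only at the
  very end.\<close>

definition program :: "com \<Rightarrow> nat \<Rightarrow> instr list" where
  "program c r = [LOADC 0 0] @ comp 1 c @ [LOADC 3 0, ADD 0 (raddr r) 3]"

text \<open>The three extra steps are the clearing of cell 0 and the two closing
  instructions.\<close>

lemma program_run:
  assumes "wp inp c Q (\<lambda>_. 0) (\<lambda>_ _. 0) 0"
  shows "\<exists>v A t. Q v A t \<and> ram_halted_within (program c r) inp (t + 3) \<and>
    snd (ram_run (program c r) inp (t + 3)) 0 = v r"
proof -
  obtain v A t where b: "bigstep inp c (\<lambda>_. 0) (\<lambda>_ _. 0) t v A" and q: "Q v A t"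
    using assms unfolding wp_def by auto
  let ?P = "program c r"
  have at: "code_at ?P 0 [LOADC 0 0]" "code_at ?P 1 (comp 1 c)"
    "code_at ?P (1 + length (comp 1 c)) [LOADC 3 0, ADD 0 (raddr r) 3]"
    using code_at_self[of "[]" ?P "[]"] unfolding program_def code_at_append by simp_all
  have 1: "(ram_step ?P inp ^^ 1) (0, (\<lambda>_. 0)(0 := length inp)) = (1, \<lambda>_. 0)"
    using at(1) by (simp add: ram_step_def fun_eq_iff)
  obtain m where m: "(ram_step ?P inp ^^ t) (1, \<lambda>_. 0) = (1 + length (comp 1 c), m)" "represents m v A"
    using comp_correct[OF b at(2), of "\<lambda>_. 0"] by (auto simp: represents_def)
  have 2: "(ram_step ?P inp ^^ 2) (1 + length (comp 1 c), m) = (length ?P, m(3 := 0, 0 := v r))"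
    using at(3) m(2) by (simp add: ram_step_def funpow_2 represents_def program_def scratch_neq)
  from funpow_trans[OF funpow_trans[OF 1 m(1)] 2]
  have "ram_run ?P inp (t + 3) = (length ?P, m(3 := 0, 0 := v r))"
    unfolding ram_run_def by (simp add: eval_nat_numeral)
  with q show ?thesis unfolding ram_halted_within_def by (metis fst_conv snd_conv fun_upd_same order_refl)
qed

text \<open>A halted machine keeps its configuration, so upper bounds on the running time
  suffice.\<close>

lemma ram_run_halted:
  assumes "ram_halted_within P inp T" "T \<le> T'"
  shows "ram_run P inp T' = ram_run P inp T"
proof -
  have "ram_run P inp (T + d) = ram_run P inp T" for d
  proof (induction d)
    case (Suc d)
    have "ram_run P inp (T + Suc d) = ram_step P inp (ram_run P inp (T + d))"
      by (simp add: ram_run_def)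
    also have "\<dots> = ram_run P inp T"
      using assms(1) Suc by (simp add: ram_step_def ram_halted_within_def)
    finally show ?case .
  qed simp
  from this[of "T' - T"] assms(2) show ?thesis by simp
qed

section \<open>The search program\<close>

text \<open>Registers below 12 hold constants of the search; those from 18 on are scratch registers.\<close>

abbreviation (input) "rn \<equiv> 2 :: nat"
abbreviation (input) "rm \<equiv> 3 :: nat"
abbreviation (input) "rs \<equiv> 4 :: nat"
abbreviation (input) "rt \<equiv> 5 :: nat"
abbreviation (input) "rk \<equiv> 6 :: nat"
abbreviation (input) "rB \<equiv> 7 :: nat"
abbreviation (input) "rK1 \<equiv> 8 :: nat"
abbreviation (input) "rK2 \<equiv> 9 :: nat"
abbreviation (input) "rone \<equiv> 10 :: nat"
abbreviation (input) "rzero \<equiv> 11 :: nat"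
abbreviation (input) "rN \<equiv> 12 :: nat"
abbreviation (input) "rst \<equiv> 13 :: nat"
abbreviation (input) "rgo \<equiv> 14 :: nat"
abbreviation (input) "racc \<equiv> 15 :: nat"
abbreviation (input) "rv \<equiv> 16 :: nat"
abbreviation (input) "rq \<equiv> 17 :: nat"
abbreviation (input) "rc \<equiv> 18 :: nat"
abbreviation (input) "rrow \<equiv> 19 :: nat"
abbreviation (input) "rj \<equiv> 20 :: nat"
abbreviation (input) "rok \<equiv> 21 :: nat"
abbreviation (input) "rx \<equiv> 22 :: nat"
abbreviation (input) "ry \<equiv> 23 :: nat"
abbreviation (input) "re \<equiv> 24 :: nat"
abbreviation (input) "rcol \<equiv> 25 :: nat"
abbreviation (input) "rpos \<equiv> 26 :: nat"
abbreviation (input) "rcnt \<equiv> 27 :: nat"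
abbreviation (input) "ru \<equiv> 28 :: nat"
abbreviation (input) "rw \<equiv> 29 :: nat"
abbreviation (input) "rrow2 \<equiv> 30 :: nat"
abbreviation (input) "ra \<equiv> 31 :: nat"
abbreviation (input) "rd \<equiv> 32 :: nat"
abbreviation (input) "rd2 \<equiv> 33 :: nat"
abbreviation (input) "rd3 \<equiv> 34 :: nat"
abbreviation (input) "rtmp \<equiv> 35 :: nat"

abbreviation (input) move :: "nat \<Rightarrow> nat \<Rightarrow> com" where
  "move x y \<equiv> Add x y rzero"

text \<open>The sum of both truncated differences is 0 only for equal values. In a
  \<open>Cond\<close> on this register, the code for equality is therefore the second
  branch.\<close>

abbreviation (input) unequal :: "nat \<Rightarrow> nat \<Rightarrow> nat \<Rightarrow> com" where
  "unequal d x y \<equiv> Sub rtmp x y ;; Sub d y x ;; Add d d rtmp"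

lemma diff_sum_eq_0 [simp]: "(a::nat) - b + (b - a) = 0 \<longleftrightarrow> a = b"
  by auto

text \<open>The guard \<open>rx + 1 - b\<close> is nonzero exactly while \<open>rx\<close> is at
  least \<open>b\<close>. The remainder goes to \<open>c\<close> and the quotient back to
  \<open>rx\<close>, ready for the next digit.\<close>

definition Divmod :: "nat \<Rightarrow> nat \<Rightarrow> com" where
  "Divmod b c = Const ry 0 ;; Add rd rx rone ;; Sub rd rd b ;;
     While rd (Sub rx rx b ;; Add ry ry rone ;; Add rd rx rone ;; Sub rd rd b) ;;
     move c rx ;; move rx ry"

lemma wp_Divmod:
  assumes pos: "v b > 0" "v rone = 1" "v rzero = 0"
    and regs: "b \<notin> {rx, ry, rd}" "c \<notin> {rx, ry, rd, rzero}"
    and Q: "\<And>v' t'. \<lbrakk>v' rx = v rx div v b; v' c = v rx mod v b; \<forall>x. x \<notin> {rx, ry, rd, c} \<longrightarrow> v' x = v x;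
      t' \<le> t + 6 + 7 * v rx\<rbrakk> \<Longrightarrow> Q v' A t'"
  shows "wp inp (Divmod b c) Q v A t"
proof -
  let ?X = "v rx" and ?b = "v b"
  define I where "I i v' A' t' \<longleftrightarrow> A' = A \<and> v' rx = ?X - i * ?b \<and> v' ry = i \<and> v' rd = ?X - i * ?b + 1 - ?b \<and>
    (\<forall>x. x \<notin> {rx, ry, rd} \<longrightarrow> v' x = v x) \<and> t' \<le> t + 3 + 7 * i" for i v' A' t'
  have fin: "?X div ?b * ?b \<le> ?X" "?X - ?X div ?b * ?b = ?X mod ?b" "?X mod ?b < ?b"
    using pos by (simp_all add: minus_div_mult_eq_mod)
  show ?thesis
    unfolding Divmod_def wp_simps
  proof (rule wp_While[where I = I and n = "?X div ?b"])
    show "I 0 (v(ry := 0, rd := (v(ry := 0)) rx + (v(ry := 0)) rone,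
        rd := (v(ry := 0, rd := (v(ry := 0)) rx + (v(ry := 0)) rone)) rd -
          (v(ry := 0, rd := (v(ry := 0)) rx + (v(ry := 0)) rone)) b)) A (t + 1 + 1 + 1)"
      using pos regs by (simp add: I_def)
  next
    fix i v' A' t'
    assume i: "i < ?X div ?b" and I: "I i v' A' t'"
    have "Suc i * ?b \<le> ?X div ?b * ?b" using i by (intro mult_le_mono1) simp
    with fin(1) have le: "i * ?b + ?b \<le> ?X" unfolding mult_Suc by linarith
    have e: "v' b = ?b" "v' rone = 1" "A' = A" "v' rx = ?X - i * ?b" "v' ry = i" "v' rd = ?X - i * ?b + 1 - ?b"
      "\<forall>x. x \<notin> {rx, ry, rd} \<longrightarrow> v' x = v x" "t' \<le> t + 3 + 7 * i"
      using I regs pos by (auto simp: I_def)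
    show "v' rd \<noteq> 0 \<and> wp inp (Sub rx rx b ;; Add ry ry rone ;; Add rd rx rone ;; Sub rd rd b)
      (\<lambda>v A t. I (Suc i) v A (t + 2)) v' A' (t' + 1)"
      using regs pos le e by (simp add: I_def wp_simps) (simp add: ac_simps)
  next
    fix v' A' t'
    assume I: "I (?X div ?b) v' A' t'"
    have d: "v' rd = 0" using I fin by (simp add: I_def)
    have "?X div ?b \<le> ?X" by simp
    then have t: "t' + 1 + 1 + 1 \<le> t + 6 + 7 * ?X" using I unfolding I_def by linarith
    have e: "v' rx = ?X mod ?b" "v' ry = ?X div ?b" "v' rzero = 0" "\<forall>x. x \<notin> {rx, ry, rd} \<longrightarrow> v' x = v x"
      using I fin pos by (simp_all add: I_def)
    have "A' = A" using I by (simp add: I_def)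
    moreover have "Q (v'(c := v' rx + v' rzero, rx := (v'(c := v' rx + v' rzero)) ry + (v'(c := v' rx + v' rzero)) rzero))
      A (t' + 1 + 1 + 1)"
      by (rule Q) (use e t regs in auto)
    ultimately show "v' rd = 0 \<and> Q (v'(c := v' rx + v' rzero, rx := (v'(c := v' rx + v' rzero)) ry + (v'(c := v' rx + v' rzero)) rzero))
      A' (t' + 1 + 1 + 1)" using d by simp
  qed
qed

section \<open>Relaxation of all edges and tables of reachable vertices\<close>

definition edge_input :: "nat list \<Rightarrow> (nat \<times> nat) list \<Rightarrow> bool" where
  "edge_input inp es \<longleftrightarrow> (\<forall>i<length es. read_input inp (5 + 2 * i) = fst (es ! i) \<and>
     read_input inp (6 + 2 * i) = snd (es ! i))"

text \<open>A functional model of one pass of the program over the edges. On a graph with vertices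
  below \<open>n\<close> it reads marks in one row and sets them in the next, so updating in place
  has the effect of a simultaneous update.\<close>

fun relax :: "(nat \<times> nat) list \<Rightarrow> nat \<Rightarrow> nat \<Rightarrow> (nat \<Rightarrow> nat) \<Rightarrow> nat \<Rightarrow> nat \<Rightarrow> nat \<Rightarrow> nat \<Rightarrow>
    (nat \<Rightarrow> nat) \<times> (nat \<Rightarrow> nat) \<Rightarrow> (nat \<Rightarrow> nat) \<times> (nat \<Rightarrow> nat)" where
  "relax es q c U st row n 0 RP = RP"
| "relax es q c U st row n (Suc i) RP = (let (R, P) = relax es q c U st row n i RP in
     if i mod q = c \<and> U i \<noteq> st \<and> R (row + fst (es ! i)) = st
     then (R(row + n + snd (es ! i) := st), P(row + n + snd (es ! i) := i)) else (R, P))"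

text \<open>\<open>rcol\<close> runs through the residues of the edge index modulo \<open>rq\<close>. For \<open>rq = 0\<close> it never wraps around, in accordance
  with \<open>e mod 0 = e\<close>. An array entry is marked if it equals the stamp \<open>rst\<close>; stamps grow from round to
  round, so that the arrays never have to be cleared.\<close>

definition Layer :: com where
  "Layer = Const re 0 ;; Const rcol 0 ;; Const rpos 5 ;; move rcnt rm ;; Add rrow2 rrow rn ;;
     While rcnt (
       Read ru rpos ;; Add rpos rpos rone ;; Read rw rpos ;; Add rpos rpos rone ;;
       Get ra AU re ;; unequal rd2 ra rst ;;
       Add ra rrow ru ;; Get ra AR ra ;; unequal rd3 ra rst ;;
       unequal rd rcol rc ;;
       Cond rd Skip (Cond rd2 (Cond rd3 Skip
         (Add ra rrow2 rw ;; Put AR ra rst ;; Put AP ra re)) Skip) ;;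
       Add re re rone ;; Add rcol rcol rone ;; unequal rd rcol rq ;; Cond rd Skip (Const rcol 0) ;;
       Sub rcnt rcnt rone) ;;
     move rrow rrow2"

lemma wp_Layer:
  assumes inp: "edge_input inp es"
    and regs: "v rone = 1" "v rzero = 0" "v rm = length es"
    and Q: "\<And>v' A' t'. \<lbrakk>v' rrow = v rrow + v rn;
      \<forall>x. x \<notin> {rrow, re, rcol, rpos, rcnt, ru, rw, rrow2, ra, rd, rd2, rd3, rtmp} \<longrightarrow> v' x = v x;
      A' AU = A AU;
      (A' AR, A' AP) = relax es (v rq) (v rc) (A AU) (v rst) (v rrow) (v rn) (length es) (A AR, A AP);
      t' \<le> t + 7 + 60 * length es\<rbrakk> \<Longrightarrow> Q v' A' t'"
  shows "wp inp Layer Q v A t"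
proof -
  \<comment> \<open>The 60 steps per edge are rounded up, so that all branches of the loop body fit
    without exact counting.\<close>
  define I where "I i v' A' t' \<longleftrightarrow> v' re = i \<and> v' rcol = i mod v rq \<and> v' rpos = 5 + 2 * i \<and>
    v' rcnt = length es - i \<and> v' rrow2 = v rrow + v rn \<and> 
    (\<forall>x. x \<notin> {re, rcol, rpos, rcnt, ru, rw, rrow2, ra, rd, rd2, rd3, rtmp} \<longrightarrow> v' x = v x) \<and>
    A' AU = A AU \<and>
    (A' AR, A' AP) = relax es (v rq) (v rc) (A AU) (v rst) (v rrow) (v rn) i (A AR, A AP) \<and>
    t' \<le> t + 5 + 60 * i" for i v' A' t'
  show ?thesis
    unfolding Layer_def wp_Seq
    apply (simp only: wp_simps)
    apply (rule wp_While[where I = I and n = "length es"])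
    subgoal using regs by (simp add: I_def)
    subgoal premises p for i v' A' t'
    proof -
      from p(2) have I: "v' re = i" "v' rcol = i mod v rq" "v' rpos = 5 + 2 * i"
        "v' rcnt = length es - i" "v' rrow2 = v rrow + v rn"
        "A' AU = A AU"
        and fr: "\<forall>x. x \<notin> {re, rcol, rpos, rcnt, ru, rw, rrow2, ra, rd, rd2, rd3, rtmp} \<longrightarrow> v' x = v x"
        and lay: "relax es (v rq) (v rc) (A AU) (v rst) (v rrow) (v rn) i (A AR, A AP) = (A' AR, A' AP)"
        and t: "t' \<le> t + 5 + 60 * i"
        by (simp_all add: I_def)
      have g: "v' rone = 1" "v' rq = v rq" "v' rc = v rc" "v' rst = v rst" "v' rrow = v rrow" "v' rn = v rn"
        using fr regs by simp_all
      have r: "read_input inp (5 + 2 * i) = fst (es ! i)" "read_input inp (6 + 2 * i) = snd (es ! i)"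
        using inp p(1) by (simp_all add: edge_input_def)
      have "v' rcnt \<noteq> 0" using I p(1) by simp
      then show ?thesis
        using p(1) fr t
        by (simp add: wp_simps I g r I_def lay mod_Suc)
    qed
    subgoal premises p for v' A' t'
    proof -
      have "v' rcnt = 0" using p by (simp add: I_def)
      moreover have "wp inp (move rrow rrow2) Q v' A' (t' + 1)"
        unfolding wp_simps by (rule Q) (use p regs in \<open>auto simp: I_def\<close>)
      ultimately show ?thesis by simp
    qed
    done
qed

text \<open>Only the current stamp is ever written, so entries never exceed it and are all out of
  date once the stamp grows.\<close>

lemma relax_bounds:
  "relax es q c U st row n i (R, P) = (R', P') \<Longrightarrow> R' x = R x \<or> R' x = st"
  by (induction i arbitrary: R' P') (auto split: if_splits prod.splits)

text \<open>The row that edges start from is never written, which is why all conditions can speak of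
  the old \<open>R\<close>. A stored edge is promised only for entries marked by this very
  pass.\<close>

lemma relax_spec:
  assumes "relax es q c U st row n i (R, P) = (R', P')" "i \<le> length es" "set es \<subseteq> {..<n} \<times> {..<n}"
  shows "(\<forall>x. x < row + n \<or> row + 2 * n \<le> x \<longrightarrow> R' x = R x \<and> P' x = P x) \<and>
    (\<forall>w<n. R' (row + n + w) = st \<longleftrightarrow> R (row + n + w) = st \<or>
      (\<exists>e<i. e mod q = c \<and> U e \<noteq> st \<and> R (row + fst (es ! e)) = st \<and> snd (es ! e) = w)) \<and>
    (\<forall>w<n. R' (row + n + w) = st \<longrightarrow> R (row + n + w) \<noteq> st \<longrightarrow>
      (\<exists>e<i. P' (row + n + w) = e \<and> e mod q = c \<and> U e \<noteq> st \<and> R (row + fst (es ! e)) = st \<and> snd (es ! e) = w))"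
  using assms(1,2)
proof (induction i arbitrary: R' P')
  case (Suc i)
  obtain R1 P1 where 1: "relax es q c U st row n i (R, P) = (R1, P1)" by fastforce
  note IH = Suc.IH[OF 1 Suc_leD[OF Suc.prems(2)]]
  have "es ! i \<in> set es" using Suc.prems(2) by simp
  then have b: "fst (es ! i) < n" "snd (es ! i) < n" using assms(3) by (metis mem_Sigma_iff lessThan_iff prod.collapse subsetD)+
  have R1: "R1 (row + fst (es ! i)) = R (row + fst (es ! i))" using IH b by auto
  show ?case
  proof (cases "i mod q = c \<and> U i \<noteq> st \<and> R (row + fst (es ! i)) = st")
    case True
    then have e: "R' = R1(row + n + snd (es ! i) := st)" "P' = P1(row + n + snd (es ! i) := i)"
      using Suc.prems(1) 1 R1 by simp_all
    show ?thesis unfolding e using IH b True by (auto simp: less_Suc_eq)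
  next
    case False
    then have e: "R' = R1" "P' = P1"
      using Suc.prems(1) 1 R1 by (simp_all split: if_splits)
    show ?thesis unfolding e using IH False by (auto simp: less_Suc_eq)
  qed
qed simp

text \<open>Row \<open>i\<close> marks the ends of the walks of length \<open>i\<close> from \<open>a\<close> whose \<open>h\<close>-th edge satisfies \<open>al h\<close>; for \<open>i > 0\<close>
  the array \<open>P\<close> stores a last edge of such a walk.\<close>

definition table :: "(nat \<times> nat) list \<Rightarrow> nat \<Rightarrow> nat \<Rightarrow> nat \<Rightarrow> nat \<Rightarrow> (nat \<Rightarrow> nat \<Rightarrow> bool) \<Rightarrow> nat \<Rightarrow>
    (nat \<Rightarrow> nat) \<Rightarrow> (nat \<Rightarrow> nat) \<Rightarrow> bool" where
  "table es n st row a al j R P \<longleftrightarrow>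
     (\<forall>i\<le>j. \<forall>w<n. R (row + i * n + w) = st \<longleftrightarrow>
       (\<exists>is. iwalk es a w is \<and> length is = i \<and> (\<forall>h<i. al h (is ! h)))) \<and>
     (\<forall>i<j. \<forall>w<n. R (row + Suc i * n + w) = st \<longrightarrow>
       (\<exists>e<length es. P (row + Suc i * n + w) = e \<and> al i e \<and>
         R (row + i * n + fst (es ! e)) = st \<and> snd (es ! e) = w)) \<and>
     (\<forall>x\<ge>row + Suc j * n. R x \<noteq> st)"

lemma table_0:
  assumes "\<forall>x\<ge>row. R x \<noteq> st" "a < n"
  shows "table es n st row a al 0 (R(row + a := st)) P"
  using assms by (auto simp: table_def)

text \<open>A walk of length \<open>j + 1\<close> is a walk of length \<open>j\<close> plus a last
  edge. Since nothing behind row \<open>j\<close> was marked, all marks in the new row come from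
  this pass and have a stored last edge.\<close>

lemma table_Suc:
  assumes T: "table es n st row a al j R P"
    and relax: "relax es q c U st (row + j * n) n (length es) (R, P) = (R', P')"
    and al: "\<And>e. e < length es \<Longrightarrow> al j e \<longleftrightarrow> e mod q = c \<and> U e \<noteq> st"
    and V: "set es \<subseteq> {..<n} \<times> {..<n}"
  shows "table es n st row a al (Suc j) R' P'"
proof -
  note rs = relax_spec[OF relax order_refl V]
  have eq: "row + Suc i * n + w = row + i * n + n + w" for i w by simp
  have old: "R' (row + i * n + w) = R (row + i * n + w)" "P' (row + i * n + w) = P (row + i * n + w)"
    if "i \<le> j" "w < n" for i w
  proof -
    have "i * n \<le> j * n" using that by simp
    then have "row + i * n + w < row + j * n + n" using that by linarith
    then show "R' (row + i * n + w) = R (row + i * n + w)" "P' (row + i * n + w) = P (row + i * n + w)"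
      using rs by blast+
  qed
  have V': "fst (es ! e) < n" "snd (es ! e) < n" if "e < length es" for e
  proof -
    have "es ! e \<in> set es" using that by simp
    then show "fst (es ! e) < n" "snd (es ! e) < n" using V by (metis mem_Sigma_iff lessThan_iff prod.collapse subsetD)+
  qed
  have new0: "R (row + j * n + n + w) \<noteq> st" for w using T by (simp add: table_def)
  have reach: "R (row + i * n + w) = st \<longleftrightarrow> (\<exists>is. iwalk es a w is \<and> length is = i \<and> (\<forall>h<i. al h (is ! h)))"
    if "i \<le> j" "w < n" for i w using T that unfolding table_def by blast
  have new: "R' (row + j * n + n + w) = st \<longleftrightarrow>
      (\<exists>e<length es. al j e \<and> R (row + j * n + fst (es ! e)) = st \<and> snd (es ! e) = w)" if "w < n" for w
    using rs that new0 al by blast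
  have "(\<exists>is. iwalk es a w is \<and> length is = Suc j \<and> (\<forall>h<Suc j. al h (is ! h))) \<longleftrightarrow>
      (\<exists>e<length es. al j e \<and> R (row + j * n + fst (es ! e)) = st \<and> snd (es ! e) = w)" (is "?L \<longleftrightarrow> ?R")
    if "w < n" for w
  proof
    assume ?L
    then obtain "is" where i: "iwalk es a w is" "length is = Suc j" "\<forall>h<Suc j. al h (is ! h)" by blast
    then obtain xs e where xs: "is = xs @ [e]" by (metis length_Suc_conv_rev)
    have "al j e" using i xs by (metis length_append_singleton lessI nat.inject nth_append_length)
    moreover have e: "e < length es" "snd (es ! e) = w" "iwalk es a (fst (es ! e)) xs"
      using i(1) xs by (auto simp: iwalk_append)
    moreover have "\<forall>h<j. al h (xs ! h)" using i(2,3) xs by (metis length_append_singleton less_SucI nat.inject nth_append)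
    moreover have "length xs = j" using i xs by simp
    ultimately show ?R using reach[of j "fst (es ! e)"] V'[of e] by blast
  next
    assume ?R
    then obtain e where e: "e < length es" "al j e" "R (row + j * n + fst (es ! e)) = st" "snd (es ! e) = w" by blast
    then obtain xs where xs: "iwalk es a (fst (es ! e)) xs" "length xs = j" "\<forall>h<j. al h (xs ! h)"
      using reach[of j "fst (es ! e)"] V'[of e] by blast
    have "iwalk es a w (xs @ [e])" using xs e by (auto simp: iwalk_append)
    moreover have "\<forall>h<Suc j. al h ((xs @ [e]) ! h)" using xs e(2) by (auto simp: nth_append less_Suc_eq)
    ultimately show ?L using xs(2) by (intro exI[of _ "xs @ [e]"]) auto
  qed
  with new have newr: "R' (row + Suc j * n + w) = st \<longleftrightarrow>
      (\<exists>is. iwalk es a w is \<and> length is = Suc j \<and> (\<forall>h<Suc j. al h (is ! h)))" if "w < n" for w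
    using that unfolding eq by blast
  show ?thesis unfolding table_def
  proof (intro conjI allI impI)
    fix i w assume "i \<le> Suc j" "w < n"
    then show "R' (row + i * n + w) = st \<longleftrightarrow>
      (\<exists>is. iwalk es a w is \<and> length is = i \<and> (\<forall>h<i. al h (is ! h)))"
      using newr[of w] reach[of i w] old[of i w] by (cases "i = Suc j") auto
  next
    fix i w assume i: "i < Suc j" and w: "w < n" and r: "R' (row + Suc i * n + w) = st"
    have o: "R' (row + i * n + fst (es ! e)) = R (row + i * n + fst (es ! e))" if "e < length es" for e
      using old[of i "fst (es ! e)"] i V'[OF that] by auto
    show "\<exists>e<length es. P' (row + Suc i * n + w) = e \<and> al i e \<and>
         R' (row + i * n + fst (es ! e)) = st \<and> snd (es ! e) = w"
    proof (cases "i = j")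
      case True
      then show ?thesis using rs w r new0[of w] al o unfolding eq by metis
    next
      case False
      then have "Suc i \<le> j" "i < j" using i by auto
      then have "R (row + Suc i * n + w) = st" using r old(1)[of "Suc i" w] w by simp
      then obtain e where "e < length es" "P (row + Suc i * n + w) = e" "al i e"
        "R (row + i * n + fst (es ! e)) = st" "snd (es ! e) = w"
        using T \<open>i < j\<close> w unfolding table_def by blast
      then show ?thesis using old(2)[of "Suc i" w] \<open>Suc i \<le> j\<close> w o by metis
    qed
  next
    fix x assume "row + Suc (Suc j) * n \<le> x"
    then have "row + j * n + 2 * n \<le> x" "row + Suc j * n \<le> x" by auto
    then show "R' x \<noteq> st" using rs T unfolding table_def by metis
  qed
qed

section \<open>One round of the search\<close>

definition Phase1 :: com where
  "Phase1 = Const rrow 0 ;; Add ra rrow rs ;; Put AR ra rst ;; move rj rK1 ;;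
     While rj (Divmod rB rc ;; Layer ;; Sub rj rj rone)"

text \<open>The marks in \<open>AU\<close> serve twice: meeting one again reveals a repeated edge,
  and afterwards they are the edges that the second part has to avoid.\<close>

definition Walkback :: com where
  "Walkback = Const rok 1 ;; move ry rv ;; move rrow2 rrow ;; move rj rK1 ;;
     While rj (Add ra rrow2 ry ;; Get re AP ra ;; Get ra AU re ;; unequal rd ra rst ;;
       Cond rd Skip (Const rok 0) ;; Put AU re rst ;;
       Const rpos 5 ;; Add rpos rpos re ;; Add rpos rpos re ;; Read ry rpos ;;
       Sub rrow2 rrow2 rn ;; Sub rj rj rone)"

definition Check :: com where
  "Check = Add ra rrow rt ;; Get ra AR ra ;; unequal rd ra rst ;; Cond rd Skip (Const racc 1)"

text \<open>With modulus 1 and colour 0 every edge passes the colour test, so the same layer program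
  becomes a plain search outside the marked edges. It starts one row beyond the first table, where
  no entry has the current stamp.\<close>

definition Phase2 :: com where
  "Phase2 = Add rrow rrow rn ;; Add ra rrow rv ;; Put AR ra rst ;; Const rq 1 ;; Const rc 0 ;; move rj rK2 ;; Check ;;
     While rj (Layer ;; Check ;; Sub rj rj rone)"

definition Verify :: com where
  "Verify = Add ra rrow rv ;; Get ra AR ra ;; unequal rd ra rst ;;
     Cond rd Skip (Walkback ;; Cond rok Phase2 Skip) ;;
     Add rN rN rone"

text \<open>Round \<open>N\<close> reads the end vertex, the modulus and the colours of the first part off the digits of \<open>N\<close>.
  A nonzero rest after the last digit means that all choices have been tried.\<close>

definition Body :: com where
  "Body = Add rst rN rone ;; move rx rN ;; Divmod rn rv ;; Divmod rB rq ;; Phase1 ;;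
     Cond rx (Const rgo 0) Skip ;; Verify"

locale ram_instance =
  fixes inp :: "nat list" and es :: "(nat \<times> nat) list" and n s t B K1 K2 :: nat
  assumes inp: "edge_input inp es"
    and vertices: "set es \<subseteq> {..<n} \<times> {..<n}" "s < n" "t < n"
    and B: "0 < B"
begin

definition globals :: "vars \<Rightarrow> bool" where
  "globals v \<longleftrightarrow> v rone = 1 \<and> v rzero = 0 \<and> v rm = length es \<and> v rn = n \<and> v rs = s \<and> v rt = t \<and>
     v rB = B \<and> v rK1 = K1 \<and> v rK2 = K2"

lemma globals_cong: "globals v \<Longrightarrow> \<forall>x<12. v' x = v x \<Longrightarrow> globals v'"
  by (simp add: globals_def)

lemma edge_vertices: "e < length es \<Longrightarrow> fst (es ! e) < n" "e < length es \<Longrightarrow> snd (es ! e) < n"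
  using vertices(1) by (metis nth_mem mem_Sigma_iff lessThan_iff prod.collapse subsetD)+

lemma relax_AR_le:
  assumes "(A' AR, A' AP) = relax es q c U st row n i (A AR, A AP)" "\<forall>x. A AR x \<le> st"
  shows "\<forall>x. A' AR x \<le> st"
  using relax_bounds[OF assms(1)[symmetric]] assms(2) by (metis order_refl)

lemma wp_Phase1:
  assumes g: "globals v" and X: "v rx = X" "v rq = q" "v rst = st" "al = (\<lambda>h e. e mod q = X div B ^ h mod B)"
    and A: "\<forall>x. A AR x < st" "\<forall>x. A AU x < st"
    and Q: "\<And>v' A' t'. \<lbrakk>\<forall>x<18. v' x = v x; v' rrow = K1 * n; v' rx = X div B ^ K1;
      table es n st 0 s al K1 (A' AR) (A' AP); \<forall>x. A' AR x \<le> st; A' AU = A AU;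
      t' \<le> t0 + 9 + K1 * (17 + 7 * X + 60 * length es)\<rbrakk> \<Longrightarrow> Q v' A' t'"
  shows "wp inp Phase1 Q v A t0"
proof -
  \<comment> \<open>Per layer: \<open>6 + 7 * X\<close> for the division,
    \<open>7 + 60 * length es\<close> for the pass, 1 for the counter and 3 for the loop.\<close>
  define T where "T = 17 + 7 * X + 60 * length es"
  define I where "I j v' A' t' \<longleftrightarrow> (\<forall>x<18. v' x = v x) \<and> v' rj = K1 - j \<and> v' rrow = j * n \<and> v' rx = X div B ^ j \<and>
    table es n st 0 s al j (A' AR) (A' AP) \<and> (\<forall>x. A' AR x \<le> st) \<and> A' AU = A AU \<and>
    t' \<le> t0 + 8 + j * T" for j v' A' t'
  have g': "v rone = 1" "v rzero = 0" "v rm = length es" "v rn = n" "v rs = s" "v rB = B" "v rK1 = K1"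
    using g by (simp_all add: globals_def)
  show ?thesis
    unfolding Phase1_def
    apply (simp only: wp_simps)
    apply (rule wp_While[where I = I and n = K1])
    subgoal
      using table_0[of 0 "A AR" st s n es al "A AP"] A vertices by (auto simp: I_def g' X less_imp_le)
    subgoal premises p for j v' A' t'
    proof -
      note I = p(2)[unfolded I_def]
      have v': "v' rone = 1" "v' rzero = 0" "v' rm = length es" "v' rn = n" "v' rB = B" "v' rst = st" "v' rq = q"
        using I g' X by simp_all
      have "wp inp (Divmod rB rc ;; Layer ;; Sub rj rj rone) (\<lambda>v A t. I (Suc j) v A (t + 2)) v' A' (t' + 1)"
        unfolding wp_Seq
      proof (rule wp_Divmod)
        fix v1 t1
        assume 1: "v1 rx = v' rx div v' rB" "v1 rc = v' rx mod v' rB" "\<forall>x. x \<notin> {rx, ry, rd, rc} \<longrightarrow> v1 x = v' x"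
          "t1 \<le> t' + 1 + 6 + 7 * v' rx"
        then have v1: "v1 rone = 1" "v1 rzero = 0" "v1 rm = length es" "v1 rn = n" "v1 rst = st" "v1 rq = q"
          "v1 rrow = j * n" "v1 rj = K1 - j" using v' I by simp_all
        show "wp inp Layer (wp inp (Sub rj rj rone) (\<lambda>v A t. I (Suc j) v A (t + 2))) v1 A' t1"
        proof (rule wp_Layer[OF inp v1(1,2,3)])
          fix v2 A2 t2
          assume 2: "v2 rrow = v1 rrow + v1 rn"
            "\<forall>x. x \<notin> {rrow, re, rcol, rpos, rcnt, ru, rw, rrow2, ra, rd, rd2, rd3, rtmp} \<longrightarrow> v2 x = v1 x"
            "A2 AU = A' AU"
            "(A2 AR, A2 AP) = relax es (v1 rq) (v1 rc) (A' AU) (v1 rst) (v1 rrow) (v1 rn) (length es) (A' AR, A' AP)"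
            "t2 \<le> t1 + 7 + 60 * length es"
          have fr: "\<forall>x<18. v2 x = v x" using 2(2) 1(3) I by auto
          have c: "v1 rc = X div B ^ j mod B" using 1(2) I v' by simp
          have tb: "table es n st 0 s al (Suc j) (A2 AR) (A2 AP)"
          proof (rule table_Suc)
            show "table es n st 0 s al j (A' AR) (A' AP)" using I by blast
            show "relax es q (X div B ^ j mod B) (A' AU) st (0 + j * n) n (length es) (A' AR, A' AP) = (A2 AR, A2 AP)"
              using 2(4) v1 c by simp
            \<comment> \<open>All entries of \<open>AU\<close> are still below the current stamp, so
              only the colour restricts the edges in this phase.\<close>
            show "al j e \<longleftrightarrow> e mod q = X div B ^ j mod B \<and> A' AU e \<noteq> st" for e
              using X(4) I A(2) by (metis less_irrefl)
          qed (rule vertices)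
          have st: "\<forall>x. A2 AR x \<le> st" by (rule relax_AR_le[OF 2(4)[unfolded v1]]) (use I in blast)
          have "v' rx \<le> X" using I by simp
          then have tm: "t2 + 3 \<le> t0 + 8 + Suc j * T"
            using 2(5) 1(4) I unfolding T_def mult_Suc by linarith
          have "v2 rx = X div B ^ Suc j" using 2(2) 1(1) I v' by (simp add: div_mult2_eq[symmetric] mult.commute)
          then show "wp inp (Sub rj rj rone) (\<lambda>v A t. I (Suc j) v A (t + 2)) v2 A2 t2"
            using fr tb st tm 2(1,2,3) v1 I by (simp add: wp_simps I_def)
        qed
      qed (use v' B in simp_all)
      then show ?thesis using p(1) I by simp
    qed
    subgoal premises p for v' A' t'
    proof -
      note I = p[unfolded I_def]
      have "Q v' A' (t' + 1)" by (rule Q) (use I T_def in auto)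
      then show ?thesis using I by simp
    qed
    done
qed

text \<open>The walk is rebuilt from its end, so after \<open>j\<close> steps a suffix is known,
  whose edge \<open>h\<close> has to satisfy condition \<open>K1 - j + h\<close>. The marks in
  \<open>AU\<close> are the edges of this suffix, so one lookup per edge decides
  distinctness.\<close>

lemma wp_Walkback:
  assumes g: "globals v" and v: "v rst = st" "v rrow = K1 * n" "v rv = y" "y < n"
    and T: "table es n st 0 s al K1 (A AR) (A AP)" "A AR (K1 * n + y) = st"
    and A: "\<forall>x. A AU x < st"
    and Q: "\<And>v' A' t' is. \<lbrakk>\<forall>x<20. v' x = v x; A' AR = A AR; iwalk es s y is; length is = K1;
      \<forall>h<K1. al h (is ! h); v' rok \<noteq> 0 \<longleftrightarrow> distinct is; \<forall>e. A' AU e \<le> st; \<forall>e. A' AU e = st \<longleftrightarrow> e \<in> set is;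
      t' \<le> t0 + 5 + K1 * 40\<rbrakk> \<Longrightarrow> Q v' A' t'"
  shows "wp inp Walkback Q v A t0"
proof -
  define I where "I j v' A' t' \<longleftrightarrow> (\<forall>x<20. v' x = v x) \<and> v' rj = K1 - j \<and> v' rrow2 = (K1 - j) * n \<and>
    v' ry < n \<and> A AR ((K1 - j) * n + v' ry) = st \<and> A' AR = A AR \<and> A' AP = A AP \<and> (\<forall>e. A' AU e \<le> st) \<and>
    (\<exists>is. iwalk es (v' ry) y is \<and> length is = j \<and> (\<forall>h<j. al (K1 - j + h) (is ! h)) \<and>
      (v' rok \<noteq> 0 \<longleftrightarrow> distinct is) \<and> (\<forall>e. A' AU e = st \<longleftrightarrow> e \<in> set is)) \<and>
    t' \<le> t0 + 4 + j * 40" for j v' A' t'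
  have g': "v rone = 1" "v rzero = 0" "v rn = n" "v rK1 = K1"
    using g by (simp_all add: globals_def)
  show ?thesis
    unfolding Walkback_def
    apply (simp only: wp_simps)
    apply (rule wp_While[where I = I and n = K1])
    subgoal
    proof -
      have "\<forall>e. A AU e \<noteq> st" using A less_irrefl by metis
      then show ?thesis using A v T by (auto simp: I_def g' less_imp_le intro!: exI[of _ "[]"])
    qed
    subgoal premises p for j v' A' t'
    proof -
      note I = p(2)[unfolded I_def]
      then have fr: "\<forall>x<20. v' x = v x" and rj: "v' rj = K1 - j" and AR: "A' AR = A AR" and AP: "A' AP = A AP"
        and AU: "\<forall>e. A' AU e \<le> st" and tm: "t' \<le> t0 + 4 + j * 40"
        by blast+
      have v': "v' rone = 1" "v' rzero = 0" "v' rn = n" "v' rst = st" using fr g' v by simp_all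
      obtain i where i: "K1 - j = Suc i" using p(1) by (metis Suc_diff_Suc)
      then have i': "K1 - Suc j = i" "i < K1" by auto
      define e where "e = A AP (Suc i * n + v' ry)"
      have e: "e < length es" "al i e" "A AR (i * n + fst (es ! e)) = st" "snd (es ! e) = v' ry"
        using T(1) I i i' unfolding table_def e_def by auto
      obtain "is" where is1: "iwalk es (v' ry) y is" "length is = j" "\<forall>h<j. al (K1 - j + h) (is ! h)"
        "v' rok \<noteq> 0 \<longleftrightarrow> distinct is" "\<forall>e. A' AU e = st \<longleftrightarrow> e \<in> set is"
        using I by blast
      have al: "\<forall>h<Suc j. al (i + h) ((e # is) ! h)"
        using e(2) is1(3) i by (auto simp: less_Suc_eq_0_disj)
      have r: "read_input inp (5 + e + e) = fst (es ! e)"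
        using inp e(1) unfolding edge_input_def by (metis add.assoc mult_2)
      have rows: "v' rrow2 = Suc i * n" using I i by simp
      have ap: "A' AP (Suc i * n + v' ry) = e" using I by (simp add: e_def)
      have wk: "iwalk es (fst (es ! e)) y (e # is)" using is1(1) e by simp
      have di: "distinct (e # is) \<longleftrightarrow> A' AU e \<noteq> st \<and> v' rok \<noteq> 0" using is1(4,5) by simp
      have main: "I (Suc j) w A'' u"
        if w: "\<forall>x<20. w x = v' x" "w rj = v' rj - 1" "w rrow2 = i * n" "w ry = fst (es ! e)"
          "w rok = (if A' AU e = st then 0 else v' rok)"
          and A'': "A'' AR = A' AR" "A'' AP = A' AP" "A'' AU = (A' AU)(e := st)"
          and u: "u \<le> t' + 40" for w A'' u
      proof -
        have "\<exists>is. iwalk es (w ry) y is \<and> length is = Suc j \<and> (\<forall>h<Suc j. al (i + h) (is ! h)) \<and>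
          (w rok \<noteq> 0 \<longleftrightarrow> distinct is) \<and> (\<forall>x. A'' AU x = st \<longleftrightarrow> x \<in> set is)"
          by (rule exI[of _ "e # is"]) (use wk al di is1 w A'' in auto)
        moreover have "\<forall>x<20. w x = v x" using w(1) fr by simp
        moreover have "w rj = K1 - Suc j" using w(2) rj by simp
        moreover have "\<forall>x. A'' AU x \<le> st" using A''(3) AU by simp
        moreover have "u \<le> t0 + 4 + Suc j * 40" using u tm by simp
        moreover have "A'' AR = A AR" "A'' AP = A AP" using A'' AR AP by simp_all
        ultimately show ?thesis
          unfolding I_def i'(1) using w(3,4) e(3) edge_vertices(1)[OF e(1)] by simp
      qed
      have r': "read_input inp (2 * e + 5) = fst (es ! e)" using inp e(1) by (simp add: edge_input_def add.commute)
      have "wp inp (Add ra rrow2 ry ;; Get re AP ra ;; Get ra AU re ;; unequal rd ra rst ;;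
       Cond rd Skip (Const rok 0) ;; Put AU re rst ;;
       Const rpos 5 ;; Add rpos rpos re ;; Add rpos rpos re ;; Read ry rpos ;;
       Sub rrow2 rrow2 rn ;; Sub rj rj rone) (\<lambda>v A t. I (Suc j) v A (t + 2)) v' A' (t' + 1)"
      proof (cases "A' AU e = st")
        case True
        \<comment> \<open>Marking a repeated edge again changes nothing; the repetition is
          remembered in \<open>rok\<close>, which is never set back.\<close>
        then have triv: "(A' AU)(e := st) = A' AU" by auto
        show ?thesis
          by (simp add: wp_simps v' rows[simplified] ap[simplified] True)
            (rule main; use True r' triv in \<open>simp add: v' add.commute\<close>)
      next
        case False
        show ?thesis
          by (simp add: wp_simps v' rows[simplified] ap[simplified] False)
            (rule main; use False r' in \<open>simp add: v' add.commute\<close>)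
      qed
      then show ?thesis using i I by simp
    qed
    subgoal premises p for v' A' t'
    proof -
      note I = p[unfolded I_def]
      then obtain "is" where is1: "iwalk es (v' ry) y is" "length is = K1" "\<forall>h<K1. al h (is ! h)"
        "v' rok \<noteq> 0 \<longleftrightarrow> distinct is" "\<forall>e. A' AU e = st \<longleftrightarrow> e \<in> set is"
        by auto
      \<comment> \<open>Row 0 marks only the ends of empty walks, that is, \<open>s\<close>; hence
        the rebuilt walk starts there.\<close>
      have "A AR (0 + 0 * n + w) = st \<longleftrightarrow> (\<exists>is. iwalk es s w is \<and> length is = 0 \<and> (\<forall>h<0. al h (is ! h)))" if "w < n" for w
        using T(1) that unfolding table_def by blast
      moreover have "v' ry < n" "A AR (v' ry) = st" using I by simp_all
      ultimately have "v' ry = s" by auto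
      then have "Q v' A' (t' + 1)" by (intro Q[of v' A' "is"]) (use I is1 in auto)
      then show ?thesis using I by simp
    qed
    done
qed

lemma wp_Check:
  assumes Q: "\<And>v' t'. \<lbrakk>\<forall>x. x \<notin> {ra, rd, rtmp, racc} \<longrightarrow> v' x = v x;
      v' racc = (if A AR (v rrow + v rt) = v rst then 1 else v racc); t' \<le> t0 + 12\<rbrakk> \<Longrightarrow> Q v' A t'"
  shows "wp inp Check Q v A t0"
  unfolding Check_def wp_simps by (auto intro!: Q split: if_splits)

text \<open>Row \<open>j\<close> holds the walks of length exactly \<open>j\<close>, so the target
  is looked up in every row to cover all lengths up to \<open>K2\<close>.\<close>

lemma wp_Phase2:
  assumes g: "globals v" and v: "v rst = st" "v rrow = K1 * n" "v rv = y" "y < n"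
    and T: "\<forall>x\<ge>Suc K1 * n. A AR x \<noteq> st" "\<forall>x. A AR x \<le> st"
    and Q: "\<And>v' A' t'. \<lbrakk>\<forall>x<15. v' x = v x; A' AU = A AU; \<forall>x. A' AR x \<le> st;
      v' racc = (if \<exists>js. iwalk es y t js \<and> length js \<le> K2 \<and> (\<forall>e\<in>set js. A AU e \<noteq> st) then 1 else v racc);
      t' \<le> t0 + 24 + K2 * (23 + 60 * length es)\<rbrakk> \<Longrightarrow> Q v' A' t'"
  shows "wp inp Phase2 Q v A t0"
proof -
  define tm where "tm = 23 + 60 * length es"
  define al :: "nat \<Rightarrow> nat \<Rightarrow> bool" where "al = (\<lambda>h e. A AU e \<noteq> st)"
  \<comment> \<open>Rows 0 to \<open>K1\<close> belong to the table of the first phase and carry the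
    same stamp.\<close>
  define row where "row = Suc K1 * n"
  define ok where "ok j \<longleftrightarrow> (\<exists>js. iwalk es y t js \<and> length js \<le> j \<and> (\<forall>e\<in>set js. A AU e \<noteq> st))" for j
  define I where "I j v' A' t' \<longleftrightarrow> (\<forall>x<15. v' x = v x) \<and> v' rq = 1 \<and> v' rc = 0 \<and> v' rj = K2 - j \<and> v' rrow = row + j * n \<and>
    table es n st row y al j (A' AR) (A' AP) \<and> (\<forall>x. A' AR x \<le> st) \<and> A' AU = A AU \<and>
    v' racc = (if ok j then 1 else v racc) \<and> t' \<le> t0 + 23 + j * tm" for j v' A' t'
  have g': "v rone = 1" "v rzero = 0" "v rm = length es" "v rn = n" "v rt = t" "v rK2 = K2"
    using g by (simp_all add: globals_def)
  have len: "(\<exists>js. iwalk es y t js \<and> length js = j \<and> (\<forall>h<j. al h (js ! h))) \<longleftrightarrow>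
      (\<exists>js. iwalk es y t js \<and> length js = j \<and> (\<forall>e\<in>set js. A AU e \<noteq> st))" for j
    unfolding al_def by (auto simp: all_set_conv_all_nth)
  have tab: "R (row + j * n + t) = st \<longleftrightarrow> (\<exists>js. iwalk es y t js \<and> length js = j \<and> (\<forall>e\<in>set js. A AU e \<noteq> st))"
    if "table es n st row y al j R P" for j R P
    using that vertices(3) len unfolding table_def by auto
  have ok0: "ok 0 \<longleftrightarrow> (\<exists>js. iwalk es y t js \<and> length js = 0 \<and> (\<forall>e\<in>set js. A AU e \<noteq> st))"
    unfolding ok_def by auto
  have okS: "ok (Suc j) \<longleftrightarrow> ok j \<or> (\<exists>js. iwalk es y t js \<and> length js = Suc j \<and> (\<forall>e\<in>set js. A AU e \<noteq> st))" for j
    unfolding ok_def by (auto simp: le_Suc_eq)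
  have t0: "table es n st row y al 0 ((A AR)(row + y := st)) P" for P
    by (rule table_0) (use T v in \<open>auto simp: row_def\<close>)
  show ?thesis
    unfolding Phase2_def
    apply (simp only: wp_simps)
    apply (rule wp_Check)
    apply (rule wp_While[where I = I and n = K2])
    subgoal premises p for v' t'
    proof -
      have "table es n st row y al 0 ((A AR)(row + y := st)) (A AP)" by (rule t0)
      from tab[OF this] p show ?thesis
        using t0[of "A AP"] T v g' by (auto simp: I_def ok0 row_def add.commute)
    qed
    subgoal premises p for v0 t0' j v' A' t'
    proof -
      note I = p(5)[unfolded I_def]
      have v': "v' rone = 1" "v' rzero = 0" "v' rm = length es" "v' rn = n" "v' rst = st" "v' rt = t"
        using I g' v by simp_all
      have "wp inp (Layer ;; Check ;; Sub rj rj rone) (\<lambda>v A t. I (Suc j) v A (t + 2)) v' A' (t' + 1)"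
        unfolding wp_Seq
      proof (rule wp_Layer[OF inp v'(1,2,3)])
        fix v2 A2 t2
        assume 2: "v2 rrow = v' rrow + v' rn"
          "\<forall>x. x \<notin> {rrow, re, rcol, rpos, rcnt, ru, rw, rrow2, ra, rd, rd2, rd3, rtmp} \<longrightarrow> v2 x = v' x"
          "A2 AU = A' AU"
          "(A2 AR, A2 AP) = relax es (v' rq) (v' rc) (A' AU) (v' rst) (v' rrow) (v' rn) (length es) (A' AR, A' AP)"
          "t2 \<le> t' + 1 + 7 + 60 * length es"
        have row2: "v2 rrow = row + Suc j * n" using 2(1) I v' by simp
        have tb: "table es n st row y al (Suc j) (A2 AR) (A2 AP)"
        proof (rule table_Suc)
          show "table es n st row y al j (A' AR) (A' AP)" using I by blast
          show "relax es 1 0 (A' AU) st (row + j * n) n (length es) (A' AR, A' AP) = (A2 AR, A2 AP)"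
            using 2(4) v' I by simp
          show "al j e \<longleftrightarrow> e mod 1 = 0 \<and> A' AU e \<noteq> st" for e using I by (simp add: al_def)
        qed (rule vertices)
        have st: "\<forall>x. A2 AR x \<le> st"
        proof (rule relax_AR_le)
          show "(A2 AR, A2 AP) = relax es (v' rq) (v' rc) (A' AU) st (v' rrow) n (length es) (A' AR, A' AP)"
            using 2(4) v' by simp
        qed (use I in blast)
        show "wp inp Check (wp inp (Sub rj rj rone) (\<lambda>v A t. I (Suc j) v A (t + 2))) v2 A2 t2"
        proof (rule wp_Check)
          fix v3 t3
          assume 3: "\<forall>x. x \<notin> {ra, rd, rtmp, racc} \<longrightarrow> v3 x = v2 x"
            "v3 racc = (if A2 AR (v2 rrow + v2 rt) = v2 rst then 1 else v2 racc)" "t3 \<le> t2 + 12"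
          have "v2 rt = t" "v2 rst = st" "v2 racc = (if ok j then 1 else v racc)" using 2(2) v' I by simp_all
          then have acc: "v3 racc = (if ok (Suc j) then 1 else v racc)"
            using 3(2) tab[OF tb] row2 by (auto simp: okS)
          have tm: "t3 + 3 \<le> t0 + 23 + Suc j * tm"
            using 3(3) 2(5) I unfolding tm_def mult_Suc by linarith
          have "\<forall>x<15. v3 x = v x" using 3(1) 2(2) I by auto
          moreover have "v3 rq = 1" "v3 rc = 0" "v3 rj = K2 - j" "v3 rrow = row + Suc j * n" "v3 rone = 1"
            using 3(1) 2(2) I row2 v' by simp_all
          ultimately show "wp inp (Sub rj rj rone) (\<lambda>v A t. I (Suc j) v A (t + 2)) v3 A2 t3"
            using acc tm tb st 2(3) I by (simp add: wp_simps I_def)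
        qed
      qed
      then show ?thesis using p(4) I by simp
    qed
    subgoal premises p for v0 t0' v' A' t'
    proof -
      note I = p(4)[unfolded I_def]
      have "Q v' A' (t' + 1)" by (rule Q) (use I tm_def ok_def in auto)
      then show ?thesis using I by simp
    qed
    done
qed

text \<open>Soundness holds for every guess, because \<open>racc\<close> is set only after a
  distinct walk and a disjoint continuation were found. For completeness it is unknown which walk
  the table yields, so all walks with the guessed colours have to be witnesses.\<close>

lemma wp_Verify:
  assumes g: "globals v" and v: "v rst = st" "v rrow = K1 * n" "v rv = y" "y < n"
    and T: "table es n st 0 s al K1 (A AR) (A AP)" "\<forall>x. A AR x \<le> st"
    and A: "\<forall>x. A AU x < st"
    and Q: "\<And>v' A' t'. \<lbrakk>\<forall>x<12. v' x = v x; v' rN = Suc (v rN); v' rgo = v rgo;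
      \<forall>x. A' AR x \<le> st; \<forall>x. A' AU x \<le> st;
      v' racc = v racc \<or> v' racc = 1 \<and> (\<exists>is. witness es t K1 K2 s y is);
      \<lbrakk>\<exists>is. iwalk es s y is \<and> length is = K1 \<and> (\<forall>h<K1. al h (is ! h));
        \<forall>is. iwalk es s y is \<longrightarrow> length is = K1 \<longrightarrow> (\<forall>h<K1. al h (is ! h)) \<longrightarrow> witness es t K1 K2 s y is\<rbrakk>
        \<Longrightarrow> v' racc = 1;
      t' \<le> t0 + 50 + K1 * 40 + K2 * (23 + 60 * length es)\<rbrakk> \<Longrightarrow> Q v' A' t'"
  shows "wp inp Verify Q v A t0"
proof -
  have g': "v rone = 1" using g by (simp add: globals_def)
  have reach: "A AR (K1 * n + y) = st \<longleftrightarrow> (\<exists>is. iwalk es s y is \<and> length is = K1 \<and> (\<forall>h<K1. al h (is ! h)))"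
    using T(1) v(4) unfolding table_def by auto
  show ?thesis
  proof (cases "A AR (K1 * n + y) = st")
    case False
    then have "\<not> (\<exists>is. iwalk es s y is \<and> length is = K1 \<and> (\<forall>h<K1. al h (is ! h)))" using reach by blast
    moreover have "\<not> st \<le> A AR (K1 * n + y)" using T(2) False by (metis le_antisym)
    ultimately show ?thesis unfolding Verify_def
      using False g' T(2) A by (auto simp: wp_simps v less_imp_le intro!: Q)
  next
    case True
    have 1: "wp inp Walkback (wp inp (Cond rok Phase2 Skip) (wp inp (Add rN rN rone) Q)) w A (10 + t0)"
      if "\<forall>x<20. w x = v x" for w
    proof (rule wp_Walkback[where st = st and y = y and al = al])
      show "globals w" using globals_cong[OF g] that by simp
      show "w rst = st" "w rrow = K1 * n" "w rv = y" using that v by simp_all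
      show "table es n st 0 s al K1 (A AR) (A AP)" by (rule T)
      show "A AR (K1 * n + y) = st" by (rule True)
      show "y < n" by (rule v)
      fix v1 A1 t1 "is"
      assume 1: "\<forall>x<20. v1 x = w x" "A1 AR = A AR" "iwalk es s y is" "length is = K1" "\<forall>h<K1. al h (is ! h)"
        "v1 rok \<noteq> 0 \<longleftrightarrow> distinct is" "\<forall>e. A1 AU e \<le> st" "\<forall>e. A1 AU e = st \<longleftrightarrow> e \<in> set is"
        "t1 \<le> 10 + t0 + 5 + K1 * 40"
      have v1: "\<forall>x<20. v1 x = v x" using that 1(1) by simp
      show "wp inp (Cond rok Phase2 Skip) (wp inp (Add rN rN rone) Q) v1 A1 t1"
      proof (cases "distinct is")
        case False
        then have "v1 rok = 0" using 1(6) by blast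
        have nw: "\<not> witness es t K1 K2 s y is" using False by (simp add: witness_def)
        have "wp inp (Add rN rN rone) Q v1 A1 (t1 + 1)"
          unfolding wp_simps
          by (rule Q) (use v1 1 T(2) g' nw in auto)
        then show ?thesis using \<open>v1 rok = 0\<close> by (simp add: wp_Cond wp_Skip)
      next
        case True
        then have ok: "v1 rok \<noteq> 0" using 1(6) by blast
        have "wp inp Phase2 (\<lambda>v A t. wp inp (Add rN rN rone) Q v A (t + 2)) v1 A1 (t1 + 1)"
        proof (rule wp_Phase2[where st = st and y = y])
          show "globals v1" using globals_cong[OF g] v1 by simp
          show "v1 rst = st" "v1 rrow = K1 * n" "v1 rv = y" using v1 v by simp_all
          show "y < n" by (rule v)
          show "\<forall>x\<ge>Suc K1 * n. A1 AR x \<noteq> st" using T(1) 1(2) by (simp add: table_def)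
          show "\<forall>x. A1 AR x \<le> st" using T(2) 1(2) by simp
          fix v2 A2 t2
          assume 2: "\<forall>x<15. v2 x = v1 x" "A2 AU = A1 AU" "\<forall>x. A2 AR x \<le> st"
            "v2 racc = (if \<exists>js. iwalk es y t js \<and> length js \<le> K2 \<and> (\<forall>e\<in>set js. A1 AU e \<noteq> st) then 1 else v1 racc)"
            "t2 \<le> t1 + 1 + 24 + K2 * (23 + 60 * length es)"
          \<comment> \<open>The marks are exactly the edges of \<open>is\<close>, so avoiding them
            is the disjointness demanded of a witness.\<close>
          have wit: "witness es t K1 K2 s y is \<longleftrightarrow> (\<exists>js. iwalk es y t js \<and> length js \<le> K2 \<and> (\<forall>e\<in>set js. A1 AU e \<noteq> st))"
            unfolding witness_def using 1(3,4,8) True by (auto simp: disjoint_iff)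
          show "wp inp (Add rN rN rone) Q v2 A2 (t2 + 2)"
            unfolding wp_simps
          proof (rule Q)
            let ?v = "v2(rN := v2 rN + v2 rone)"
            show "\<forall>x<12. ?v x = v x" "?v rN = Suc (v rN)" "?v rgo = v rgo" using 2(1) v1 g' by simp_all
            show "\<forall>x. A2 AR x \<le> st" "\<forall>x. A2 AU x \<le> st" using 2 1 by simp_all
            show "?v racc = v racc \<or> ?v racc = 1 \<and> (\<exists>is. witness es t K1 K2 s y is)"
              using 2(4) wit v1 by auto
            show "t2 + 2 + 1 \<le> t0 + 50 + K1 * 40 + K2 * (23 + 60 * length es)"
              using 2(5) 1(9) by linarith
            assume "\<forall>is. iwalk es s y is \<longrightarrow> length is = K1 \<longrightarrow> (\<forall>h<K1. al h (is ! h)) \<longrightarrow> witness es t K1 K2 s y is"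
            then have "witness es t K1 K2 s y is" using 1(3,4,5) by blast
            then show "?v racc = 1" using 2(4) wit by simp
          qed
        qed
        then show ?thesis using ok by (simp add: wp_Cond)
      qed
    qed (use A in auto)
    show ?thesis unfolding Verify_def
      by (simp add: wp_Seq wp_Add wp_Sub wp_Get wp_Cond[where x = rd] v True) (rule 1; simp)
  qed
qed

text \<open>Round \<open>N\<close> uses the stamp \<open>N + 1\<close>, so entries bounded by
  \<open>N\<close> are all out of date, including the initial zeros in round 0.\<close>

lemma wp_Body:
  assumes g: "globals v" and v: "v rN = N" and A: "\<forall>x. A AR x \<le> N" "\<forall>x. A AU x \<le> N"
    and Q: "\<And>v' A' t'. \<lbrakk>\<forall>x<12. v' x = v x; v' rN = Suc N;
      v' rgo = (if N div n div B div B ^ K1 = 0 then v rgo else 0);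
      \<forall>x. A' AR x \<le> Suc N; \<forall>x. A' AU x \<le> Suc N;
      v' racc = v racc \<or> v' racc = 1 \<and> solution es s t K1 K2;
      good_number es n s t K1 K2 B N \<Longrightarrow> v' racc = 1;
      t' \<le> t0 + 80 + 14 * N + K1 * (57 + 7 * N + 60 * length es) + K2 * (23 + 60 * length es)\<rbrakk> \<Longrightarrow> Q v' A' t'"
  shows "wp inp Body Q v A t0"
proof -
  have g': "v rone = 1" "v rzero = 0" "v rn = n" "v rB = B" using g by (simp_all add: globals_def)
  define X where "X = N div n div B"
  define al where "al = (\<lambda>h e. e mod (N div n mod B) = X div B ^ h mod B)"
  have np: "n > 0" using vertices by simp
  show ?thesis
    unfolding Body_def wp_Seq wp_Add
  proof (rule wp_Divmod)
    let ?v = "v(rst := v rN + v rone, rx := (v(rst := v rN + v rone)) rN + (v(rst := v rN + v rone)) rzero)"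
    show "0 < ?v rn" "?v rone = 1" "?v rzero = 0" using g' np by simp_all
    fix v1 t1
    assume "v1 rx = ?v rx div ?v rn" "v1 rv = ?v rx mod ?v rn" "\<forall>x. x \<notin> {rx, ry, rd, rv} \<longrightarrow> v1 x = ?v x"
      "t1 \<le> t0 + 1 + 1 + 6 + 7 * ?v rx"
    then have 1: "v1 rx = N div n" "v1 rv = N mod n" "\<forall>x. x \<notin> {rx, ry, rd, rv} \<longrightarrow> v1 x = ?v x"
      "t1 \<le> t0 + 8 + 7 * N" using v g' by simp_all
    have v1: "v1 rone = 1" "v1 rzero = 0" "v1 rB = B" "v1 rst = Suc N" "v1 rN = N" "v1 rgo = v rgo" "v1 racc = v racc"
      "\<forall>x<12. v1 x = v x"
      using 1(3) v g' by simp_all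
    show "wp inp (Divmod rB rq) (wp inp Phase1 (wp inp (Cond rx (Const rgo 0) Skip) (wp inp Verify Q))) v1 A t1"
    proof (rule wp_Divmod)
      show "0 < v1 rB" "v1 rone = 1" "v1 rzero = 0" using v1 B by simp_all
      fix v2 t2
      assume "v2 rx = v1 rx div v1 rB" "v2 rq = v1 rx mod v1 rB" "\<forall>x. x \<notin> {rx, ry, rd, rq} \<longrightarrow> v2 x = v1 x"
        "t2 \<le> t1 + 6 + 7 * v1 rx"
      then have 2: "v2 rx = X" "v2 rq = N div n mod B" "\<forall>x. x \<notin> {rx, ry, rd, rq} \<longrightarrow> v2 x = v1 x"
        "t2 \<le> t1 + 6 + 7 * (N div n)" using v1 1 by (simp_all add: X_def)
      have v2: "v2 rst = Suc N" "v2 rN = N" "v2 rgo = v rgo" "v2 racc = v racc" "v2 rv = N mod n"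
        "\<forall>x<12. v2 x = v x"
        using 2(3) 1 v1 by simp_all
      show "wp inp Phase1 (wp inp (Cond rx (Const rgo 0) Skip) (wp inp Verify Q)) v2 A t2"
      proof (rule wp_Phase1[OF _ 2(1) 2(2) v2(1) al_def])
        show "globals v2" using globals_cong[OF g] v2 by simp
        show "\<forall>x. A AR x < Suc N" "\<forall>x. A AU x < Suc N" using A by (simp_all add: less_Suc_eq_le)
        fix v3 A3 t3
        assume 3: "\<forall>x<18. v3 x = v2 x" "v3 rrow = K1 * n" "v3 rx = X div B ^ K1"
          "table es n (Suc N) 0 s al K1 (A3 AR) (A3 AP)" "\<forall>x. A3 AR x \<le> Suc N" "A3 AU = A AU"
          "t3 \<le> t2 + 9 + K1 * (17 + 7 * X + 60 * length es)"
        have ver: "wp inp Verify Q w A3 u"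
          if w: "\<forall>x<20. x \<noteq> rgo \<longrightarrow> w x = v3 x" "w rgo = (if X div B ^ K1 = 0 then v rgo else 0)" and u: "u \<le> t3 + 4" for w u
        proof (rule wp_Verify[where st = "Suc N" and y = "N mod n" and al = al])
          show "globals w" using globals_cong[OF g] w 3(1) v2 by simp
          show "w rst = Suc N" "w rrow = K1 * n" "w rv = N mod n" "N mod n < n" using w 3 v2 np by simp_all
          show "table es n (Suc N) 0 s al K1 (A3 AR) (A3 AP)" "\<forall>x. A3 AR x \<le> Suc N" by fact+
          show "\<forall>x. A3 AU x < Suc N" using 3(6) A by (simp add: less_Suc_eq_le)
          fix v4 :: vars and A4 :: arrs and t4
          assume 4: "\<forall>x<12. v4 x = w x" "v4 rN = Suc (w rN)" "v4 rgo = w rgo" "\<forall>x. A4 AR x \<le> Suc N" "\<forall>x. A4 AU x \<le> Suc N"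
            "v4 racc = w racc \<or> v4 racc = 1 \<and> (\<exists>is. witness es t K1 K2 s (N mod n) is)"
            "\<lbrakk>\<exists>is. iwalk es s (N mod n) is \<and> length is = K1 \<and> (\<forall>h<K1. al h (is ! h));
              \<forall>is. iwalk es s (N mod n) is \<longrightarrow> length is = K1 \<longrightarrow> (\<forall>h<K1. al h (is ! h)) \<longrightarrow>
                witness es t K1 K2 s (N mod n) is\<rbrakk> \<Longrightarrow> v4 racc = 1"
            "t4 \<le> u + 50 + K1 * 40 + K2 * (23 + 60 * length es)"
          show "Q v4 A4 t4"
          proof (rule Q)
            show "\<forall>x<12. v4 x = v x" "v4 rN = Suc N" using 4 w 3(1) v2 by simp_all
            show "v4 rgo = (if N div n div B div B ^ K1 = 0 then v rgo else 0)"
              using 4(3) w(2) unfolding X_def by simp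
            show "\<forall>x. A4 AR x \<le> Suc N" "\<forall>x. A4 AU x \<le> Suc N" by fact+
            show "v4 racc = v racc \<or> v4 racc = 1 \<and> solution es s t K1 K2"
              using 4(6) witness_solution w(1) 3(1) v2 by auto
            have "X \<le> N" unfolding X_def using div_le_dividend le_trans by blast
            then have "K1 * (17 + 7 * X + 60 * length es) \<le> K1 * (17 + 7 * N + 60 * length es)"
              by (intro mult_le_mono2) simp
            moreover have "K1 * (57 + 7 * N + 60 * length es) = K1 * (17 + 7 * N + 60 * length es) + K1 * 40"
              by (simp add: algebra_simps)
            moreover have "N div n \<le> N" by simp
            ultimately show "t4 \<le> t0 + 80 + 14 * N + K1 * (57 + 7 * N + 60 * length es) + K2 * (23 + 60 * length es)"
              using 4(8) u 3(7) 2(4) 1(4) by linarith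
            assume "good_number es n s t K1 K2 B N"
            then show "v4 racc = 1"
              using 4(7) unfolding good_number_def good_def coloured_def X_def[symmetric] al_def by metis
          qed
        qed
        have "v3 rgo = v rgo" using 3(1) v2 by simp
        then show "wp inp (Cond rx (Const rgo 0) Skip) (wp inp Verify Q) v3 A3 t3"
          unfolding wp_simps using 3(3) by (auto intro!: ver)
      qed
    qed simp_all
  qed simp_all
qed

section \<open>The loop over all guesses\<close>

definition rounds :: nat where
  "rounds = n * B ^ Suc K1"

text \<open>The constant 83 is the 80 for the body plus three steps of the enclosing loop.\<close>

definition round_time :: nat where
  "round_time = 83 + 14 * rounds + K1 * (57 + 7 * rounds + 60 * length es) + K2 * (23 + 60 * length es)"

text \<open>The rest after the last digit of \<open>i\<close> is \<open>i div rounds\<close>, which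
  is first nonzero in round \<open>rounds\<close>. That round clears \<open>rgo\<close> but still
  runs to its end, hence \<open>Suc rounds\<close> iterations; it cannot spoil the answer, as
  \<open>racc\<close> is set only for true solutions.\<close>

lemma wp_Search:
  assumes g: "globals v" and v: "v rN = 0" "v rgo = 1" "v racc = 0" and A: "\<forall>x. A AR x = 0" "\<forall>x. A AU x = 0"
    and L: "length es \<le> 2 ^ L" "4 * K1\<^sup>2 * L + 3 < B"
    and Q: "\<And>v' A' t'. \<lbrakk>v' racc = 1 \<longleftrightarrow> solution es s t K1 K2; t' \<le> t0 + 1 + Suc rounds * round_time\<rbrakk> \<Longrightarrow> Q v' A' t'"
  shows "wp inp (While rgo Body) Q v A t0"
proof -
  define I where "I i v' A' t' \<longleftrightarrow> (\<forall>x<12. v' x = v x) \<and> v' rN = i \<and> v' rgo = (if i \<le> rounds then 1 else 0) \<and>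
    (\<forall>x. A' AR x \<le> i) \<and> (\<forall>x. A' AU x \<le> i) \<and>
    (v' racc = 0 \<or> v' racc = 1 \<and> solution es s t K1 K2) \<and>
    (\<forall>N<i. good_number es n s t K1 K2 B N \<longrightarrow> v' racc = 1) \<and>
    t' \<le> t0 + i * round_time" for i v' and A' :: arrs and t'
  show ?thesis
  proof (rule wp_While[where I = I and n = "Suc rounds"])
    show "I 0 v A t0" using v A by (simp add: I_def)
  next
    fix i v' A' t'
    assume i: "i < Suc rounds" and "I i v' A' t'"
    note I = \<open>I i v' A' t'\<close>[unfolded I_def]
    have "wp inp Body (\<lambda>v A t. I (Suc i) v A (t + 2)) v' A' (t' + 1)"
    proof (rule wp_Body[where N = i])
      show "globals v'" using globals_cong[OF g] I by blast
      show "v' rN = i" "\<forall>x. A' AR x \<le> i" "\<forall>x. A' AU x \<le> i" using I by blast+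
      fix v2 :: vars and A2 :: arrs and t2
      assume 2: "\<forall>x<12. v2 x = v' x" "v2 rN = Suc i"
        "v2 rgo = (if i div n div B div B ^ K1 = 0 then v' rgo else 0)"
        "\<forall>x. A2 AR x \<le> Suc i" "\<forall>x. A2 AU x \<le> Suc i"
        "v2 racc = v' racc \<or> v2 racc = 1 \<and> solution es s t K1 K2"
        "good_number es n s t K1 K2 B i \<Longrightarrow> v2 racc = 1"
        "t2 \<le> t' + 1 + 80 + 14 * i + K1 * (57 + 7 * i + 60 * length es) + K2 * (23 + 60 * length es)"
      have "i div n div B div B ^ K1 = i div rounds" by (simp add: rounds_def div_mult2_eq)
      moreover have "rounds > 0" using vertices B by (simp add: rounds_def)
      ultimately have go: "v2 rgo = (if Suc i \<le> rounds then 1 else 0)"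
        using 2(3) I i by (auto simp: div_eq_0_iff)
      have "K1 * (57 + 7 * i + 60 * length es) \<le> K1 * (57 + 7 * rounds + 60 * length es)"
        using i by (intro mult_le_mono2) simp
      then have tm: "t2 + 2 \<le> t0 + Suc i * round_time"
        using 2(8) I i unfolding round_time_def mult_Suc by linarith
      have "\<forall>N<Suc i. good_number es n s t K1 K2 B N \<longrightarrow> v2 racc = 1"
        using 2(6,7) I by (auto simp: less_Suc_eq)
      then show "I (Suc i) v2 A2 (t2 + 2)" unfolding I_def using go tm 2(1,2,4,5,6) I by auto
    qed
    then show "v' rgo \<noteq> 0 \<and> wp inp Body (\<lambda>v A t. I (Suc i) v A (t + 2)) v' A' (t' + 1)"
      using I i by simp
  next
    fix v' A' t'
    assume "I (Suc rounds) v' A' t'"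
    note I = this[unfolded I_def]
    have "v' racc = 1" if "solution es s t K1 K2"
      using solution_good_number[OF that L vertices(1,2)] I unfolding rounds_def by (meson less_SucI)
    then have "Q v' A' (t' + 1)" by (intro Q) (use I in auto)
    then show "v' rgo = 0 \<and> Q v' A' (t' + 1)" using I by simp
  qed
qed

end

section \<open>Binary length, modulus and setup\<close>

definition bitlen :: "nat \<Rightarrow> nat" where
  "bitlen m = (LEAST L. m < 2 ^ L)"

lemma less_bitlen: "m < 2 ^ bitlen m"
  unfolding bitlen_def by (rule LeastI[of _ m]) (rule less_exp)

lemma bitlen_le: "bitlen m \<le> m"
  unfolding bitlen_def by (rule Least_le) (rule less_exp)

lemma power_le_of_less_bitlen: "i < bitlen m \<Longrightarrow> 2 ^ i \<le> m"
  unfolding bitlen_def using not_less_Least[of i "\<lambda>L. m < 2 ^ L"] by auto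

lemma power_bitlen_le: "2 ^ bitlen m \<le> 2 * m + 1"
proof (cases "bitlen m")
  case (Suc i)
  then show ?thesis using power_le_of_less_bitlen[of i m] by simp
qed simp

text \<open>The arguments name the registers copied to \<open>K1\<close> and \<open>K2\<close>, so
  one program text covers all three problems. The guard \<open>m + 1 - 2 ^ i\<close> of the first
  loop is positive exactly while \<open>2 ^ i \<le> m\<close>, so that loop counts up to
  \<open>bitlen m\<close>.\<close>

definition Setup :: "nat \<Rightarrow> nat \<Rightarrow> com" where
  "Setup a b = Const rone 1 ;; Const rgo 1 ;; Read rn rzero ;; Read rs rone ;; Const ra 2 ;; Read rt ra ;;
     Const ra 3 ;; Read rk ra ;; Const ra 4 ;; Read rm ra ;; move rK1 a ;; move rK2 b ;;
     Const rd3 1 ;; Const re 0 ;; Add rd rm rone ;; Sub rd rd rd3 ;;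
     While rd (Add rd3 rd3 rd3 ;; Add re re rone ;; Add rd rm rone ;; Sub rd rd rd3) ;;
     Const ra 2 ;; Add rB re ra ;; Add rB rB rB ;; Add rB rB rB ;; move rj rK1 ;;
     While rj (Add rB rB rB ;; Add rB rB rB ;; Sub rj rj rone)"

text \<open>\<open>4 ^ Suc K1\<close> is a bound for \<open>4 * K1\<^sup>2\<close> that repeated doubling computes.\<close>

definition modulus :: "nat \<Rightarrow> nat \<Rightarrow> nat" where
  "modulus m K1 = (bitlen m + 2) * 4 ^ Suc K1"

lemma wp_Setup:
  assumes inp: "read_input inp 0 = n" "read_input inp 1 = s" "read_input inp 2 = t" "read_input inp 3 = k" "read_input inp 4 = m"
    and K: "a \<in> {rk, rzero, rm}" "b \<in> {rk, rzero, rm}" "K1 = (if a = rk then k else if a = rm then m else 0)"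
      "K2 = (if b = rk then k else if b = rm then m else 0)"
    and Q: "\<And>v t'. \<lbrakk>v rn = n; v rs = s; v rt = t; v rm = m; v rK1 = K1; v rK2 = K2; v rone = 1; v rzero = 0;
      v rB = modulus m K1; v rN = 0; v rgo = 1; v racc = 0; t' \<le> 30 + 7 * m + 6 * K1\<rbrakk> \<Longrightarrow> Q v A t'"
  shows "wp inp (Setup a b) Q (\<lambda>_. 0) A 0"
proof -
  define G where "G v \<longleftrightarrow> v rn = n \<and> v rs = s \<and> v rt = t \<and> v rm = m \<and> v rK1 = K1 \<and> v rK2 = K2 \<and> v rone = 1 \<and> v rzero = 0 \<and>
    v rN = 0 \<and> v rgo = 1 \<and> v racc = 0" for v :: vars
  define I where "I i v A' t' \<longleftrightarrow> A' = A \<and> G v \<and> v re = i \<and> v rd3 = 2 ^ i \<and> v rd = m + 1 - 2 ^ i \<and> t' \<le> 16 + 7 * i"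
    for i v A' and t' :: nat
  define J where "J i v A' t' \<longleftrightarrow> A' = A \<and> G v \<and> v rj = K1 - i \<and> v rB = (bitlen m + 2) * 4 ^ Suc i \<and> t' \<le> 25 + 7 * m + 6 * i"
    for i v A' and t' :: nat
  show ?thesis
    unfolding Setup_def
    apply (simp only: wp_simps)
    apply (rule wp_While[where I = I and n = "bitlen m"])
    subgoal using K(1,2) by (elim insertE emptyE) (simp_all add: I_def G_def inp inp(2)[simplified] K(3,4))
    subgoal for i v A' t'
      using power_le_of_less_bitlen[of i m] by (simp add: I_def G_def wp_simps)
    subgoal premises p for v A' t'
    proof -
      have I: "A' = A" "G v" "v re = bitlen m" "v rd = m + 1 - 2 ^ bitlen m" "t' \<le> 16 + 7 * bitlen m"
        using p by (simp_all add: I_def)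
      have rd: "v rd = 0" using less_bitlen[of m] I(4) by simp
      have t': "t' \<le> 16 + 7 * m" using I(5) bitlen_le[of m] by linarith
      have "wp inp (Const ra 2 ;; Add rB re ra ;; Add rB rB rB ;; Add rB rB rB ;; move rj rK1 ;;
        While rj (Add rB rB rB ;; Add rB rB rB ;; Sub rj rj rone)) Q v A (t' + 1)"
        apply (simp only: wp_simps)
        apply (rule wp_While[where I = J and n = K1])
        subgoal using I t' by (auto simp: J_def G_def)
        subgoal for i v A' t'
          by (simp add: J_def G_def wp_simps)
        subgoal for v A' t'
          by (auto simp: J_def G_def modulus_def intro!: Q)
        done
      then show ?thesis using rd I(1) by (simp add: wp_Seq[abs_def])
    qed
    done
qed

text \<open>Squaring \<open>K1 \<le> 2 ^ K1\<close> bounds the quadratic factor by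
  \<open>4 ^ K1\<close>; the summand 2 next to \<open>bitlen m\<close> leaves
  \<open>8 * 4 ^ K1\<close> to cover the 3.\<close>

lemma modulus_large: "4 * K1\<^sup>2 * bitlen m + 3 < modulus m K1"
proof -
  have "K1 \<le> 2 ^ K1" by (simp add: less_imp_le)
  then have "K1\<^sup>2 \<le> (2 ^ K1)\<^sup>2" by (rule power_mono) simp
  also have "\<dots> = 4 ^ K1" by (simp add: power2_eq_square power_mult_distrib[symmetric])
  finally have "4 * K1\<^sup>2 * bitlen m \<le> 4 * 4 ^ K1 * bitlen m" by (intro mult_le_mono) auto
  moreover have "(1::nat) \<le> 4 ^ K1" by simp
  moreover have "modulus m K1 = 4 * 4 ^ K1 * bitlen m + 8 * 4 ^ K1"
    by (simp add: modulus_def algebra_simps)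
  ultimately show ?thesis by linarith
qed

section \<open>The complete program on encoded inputs\<close>

definition Search :: "nat \<Rightarrow> nat \<Rightarrow> com" where
  "Search a b = Setup a b ;; While rgo Body"

definition search_rounds :: "nat \<Rightarrow> nat \<Rightarrow> nat \<Rightarrow> nat" where
  "search_rounds n m K1 = n * modulus m K1 ^ Suc K1"

definition search_time :: "nat \<Rightarrow> nat \<Rightarrow> nat \<Rightarrow> nat \<Rightarrow> nat" where
  "search_time n m K1 K2 = (let F = search_rounds n m K1 in 31 + 7 * m + 6 * K1 +
     Suc F * (83 + 14 * F + K1 * (57 + 7 * F + 60 * m) + K2 * (23 + 60 * m)))"

lemma nth_concat_pairs:
  "i < length es \<Longrightarrow> concat (map (\<lambda>(u, v). [u, v]) es) ! (2 * i) = fst (es ! i)"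
  "i < length es \<Longrightarrow> concat (map (\<lambda>(u, v). [u, v]) es) ! Suc (2 * i) = snd (es ! i)"
proof (induction es arbitrary: i)
  case (Cons e es)
  { case 1 then show ?case using Cons by (cases i) (auto split: prod.splits) }
  { case 2 then show ?case using Cons by (cases i) (auto split: prod.splits) }
qed simp_all

lemma length_concat_pairs: "length (concat (map (\<lambda>(u, v). [u, v]) es)) = 2 * length es"
  by (induction es) auto

lemma encoding_input:
  assumes "inp = [n, s, t, k, length es] @ concat (map (\<lambda>(u, v). [u, v]) es)"
  shows "edge_input inp es" "read_input inp 0 = n" "read_input inp 1 = s" "read_input inp 2 = t"
    "read_input inp 3 = k" "read_input inp 4 = length es"
proof -
  show "edge_input inp es"
    unfolding edge_input_def
  proof (intro allI impI)
    fix i assume i: "i < length es"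
    let ?c = "concat (map (\<lambda>(u, v). [u, v]) es)"
    have "inp ! (5 + 2 * i) = ?c ! (2 * i)" "inp ! (6 + 2 * i) = ?c ! Suc (2 * i)"
      unfolding assms by (simp_all add: nth_append eval_nat_numeral)
    then show "read_input inp (5 + 2 * i) = fst (es ! i) \<and> read_input inp (6 + 2 * i) = snd (es ! i)"
      using i nth_concat_pairs[OF i] assms by (simp add: read_input_def length_concat_pairs)
  qed
qed (use assms in \<open>simp_all add: read_input_def eval_nat_numeral\<close>)

lemma wp_Search_program:
  assumes V: "set es \<subseteq> {..<n} \<times> {..<n}" "s < n" "t < n"
    and inp: "inp = [n, s, t, k, length es] @ concat (map (\<lambda>(u, v). [u, v]) es)"
    and K: "a \<in> {rk, rzero, rm}" "b \<in> {rk, rzero, rm}" "K1 = (if a = rk then k else if a = rm then length es else 0)"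
      "K2 = (if b = rk then k else if b = rm then length es else 0)"
  shows "wp inp (Search a b) (\<lambda>v A u. (v racc = 1 \<longleftrightarrow> solution es s t K1 K2) \<and>
    u \<le> search_time n (length es) K1 K2) (\<lambda>_. 0) (\<lambda>_ _. 0) 0"
proof -
  note inp' = encoding_input[OF inp]
  interpret ram_instance inp es n s t "modulus (length es) K1" K1 K2
    by unfold_locales (use inp' V in \<open>auto simp: modulus_def\<close>)
  show ?thesis
    unfolding Search_def wp_Seq
  proof (rule wp_Setup[OF inp'(2-6) K])
    fix v t'
    assume a: "v rn = n" "v rs = s" "v rt = t" "v rm = length es" "v rK1 = K1" "v rK2 = K2" "v rone = 1"
      "v rzero = 0" "v rB = modulus (length es) K1" "v rN = 0" "v rgo = 1" "v racc = 0"
      "t' \<le> 30 + 7 * length es + 6 * K1"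
    show "wp inp (While rgo Body) (\<lambda>v A u. (v racc = 1 \<longleftrightarrow> solution es s t K1 K2) \<and>
      u \<le> search_time n (length es) K1 K2) v (\<lambda>_ _. 0) t'"
    proof (rule wp_Search[where L = "bitlen (length es)"])
      show "globals v" using a by (simp add: globals_def)
      show "length es \<le> 2 ^ bitlen (length es)" using less_bitlen less_imp_le by blast
      show "4 * K1\<^sup>2 * bitlen (length es) + 3 < modulus (length es) K1" by (rule modulus_large)
    qed (use a in \<open>auto simp: search_time_def search_rounds_def Let_def rounds_def round_time_def\<close>)
  qed
qed

section \<open>Bounds on the running time\<close>

lemma power_self_bound: "(a::nat) ^ b \<le> b ^ b * 2 ^ a"
proof (cases "b = 0")
  case False
  have "a mod b < b" using False by simp
  moreover have "a = b * (a div b) + a mod b" by simp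
  \<comment> \<open>Bounding \<open>Suc (a div b)\<close> by \<open>2 ^ (a div b)\<close> puts
    \<open>a\<close> below \<open>b * 2 ^ (a div b)\<close>, and the \<open>b\<close>-th power of
    the exponential factor is at most \<open>2 ^ a\<close>.\<close>
  ultimately have "a \<le> b * Suc (a div b)" unfolding mult_Suc_right by linarith
  also have "\<dots> \<le> b * 2 ^ (a div b)" by (intro mult_le_mono2) (simp add: Suc_leI)
  finally have "a ^ b \<le> (b * 2 ^ (a div b)) ^ b" by (rule power_mono) simp
  also have "\<dots> = b ^ b * 2 ^ (a div b * b)" by (simp add: power_mult_distrib power_mult)
  also have "\<dots> \<le> b ^ b * 2 ^ a" by (intro mult_le_mono2 power_increasing) auto
  finally show ?thesis .
qed simp

text \<open>For \<open>j = Suc K1\<close>, the power \<open>(bitlen m + 2) ^ j\<close> is at most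
  \<open>j ^ j\<close> times a linear term. The exponent collects \<open>j\<^sup>2\<close> from
  \<open>j ^ j\<close>, \<open>2 * j\<^sup>2\<close> from the powers of 4, and 3 from the constant 8
  of the linear term.\<close>

lemma search_rounds_bound:
  assumes "K1 \<le> k"
  shows "search_rounds n m K1 \<le> 2 ^ (3 * (Suc k)\<^sup>2 + 3) * (n + m + 1)\<^sup>2"
proof -
  let ?j = "Suc K1" and ?L = "bitlen m + 2"
  have "?j \<le> 2 ^ ?j" by (simp only: less_imp_le less_exp)
  then have "?j ^ ?j \<le> (2 ^ ?j) ^ ?j" by (rule power_mono) simp
  then have jj: "?j ^ ?j \<le> 2 ^ (?j\<^sup>2)" by (simp only: power_mult power2_eq_square)
  have L: "2 ^ ?L \<le> 8 * (n + m + 1)" using power_bitlen_le[of m] by (simp add: power_add)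
  have "modulus m K1 ^ ?j = ?L ^ ?j * 4 ^ (?j\<^sup>2)"
    unfolding modulus_def by (simp only: power_mult_distrib power_mult power2_eq_square)
  also have "\<dots> \<le> (?j ^ ?j * 2 ^ ?L) * 4 ^ (?j\<^sup>2)"
    by (intro mult_le_mono1 power_self_bound)
  also have "\<dots> \<le> (2 ^ (?j\<^sup>2) * (8 * (n + m + 1))) * 4 ^ (?j\<^sup>2)"
    using jj L by (intro mult_le_mono) auto
  also have "\<dots> = 2 ^ (3 * ?j\<^sup>2 + 3) * (n + m + 1)"
  proof -
    have "(4::nat) ^ (?j\<^sup>2) = 2 ^ (2 * ?j\<^sup>2)" by (simp only: power_mult) simp
    then show ?thesis by (simp only: power_add power_mult) (simp add: power_mult_distrib[symmetric] algebra_simps power_mult[symmetric])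
  qed
  also have "\<dots> \<le> 2 ^ (3 * (Suc k)\<^sup>2 + 3) * (n + m + 1)"
  proof -
    have "?j\<^sup>2 \<le> (Suc k)\<^sup>2" using assms by (intro power_mono) auto
    then show ?thesis by (intro mult_le_mono1 power_increasing) auto
  qed
  finally have "modulus m K1 ^ ?j \<le> 2 ^ (3 * (Suc k)\<^sup>2 + 3) * (n + m + 1)" .
  then have "search_rounds n m K1 \<le> (n + m + 1) * (2 ^ (3 * (Suc k)\<^sup>2 + 3) * (n + m + 1))"
    unfolding search_rounds_def by (intro mult_le_mono) auto
  then show ?thesis by (simp only: power2_eq_square mult_ac)
qed

text \<open>Absorbs the quadratic exponent into a power of 2, so that the final bound is computed by
  two doubling loops.\<close>

lemma exponent_bound: "6 * (Suc k)\<^sup>2 + 15 + k \<le> 2 ^ (k + 5)"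
proof (induction k)
  case (Suc k)
  have "6 * (Suc (Suc k))\<^sup>2 + 15 + Suc k \<le> 2 * (6 * (Suc k)\<^sup>2 + 15 + k)"
    by (simp add: power2_eq_square algebra_simps)
  also have "\<dots> \<le> 2 * 2 ^ (k + 5)" using Suc by (intro mult_le_mono2)
  finally show ?case by (simp only: add_Suc power_Suc)
qed simp

text \<open>A round divides its own number by repeated subtraction, so the time of a round is linear
  in the number of rounds and the total is quadratic in it. As \<open>Y\<close> bounds that number
  and contains \<open>X\<^sup>2\<close>, the total has \<open>X ^ 4\<close>.\<close>

lemma search_time_bound:
  assumes "K1 \<le> k" "K2 \<le> k + m"
  shows "search_time n m K1 K2 + 3 \<le> 2 ^ 2 ^ (k + 5) * (n + m + 1) ^ 4"
proof -
  define X where "X = n + m + 1"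
  define F where "F = search_rounds n m K1"
  define G where "G = (2::nat) ^ (3 * (Suc k)\<^sup>2 + 3)"
  define Y where "Y = G * X\<^sup>2"
  have F: "F \<le> Y" using search_rounds_bound[OF assms(1)] unfolding F_def Y_def G_def X_def .
  have G1: "1 \<le> G" by (simp add: G_def)
  have X1: "1 \<le> X" "m \<le> X" by (simp_all add: X_def)
  have XX: "X \<le> X\<^sup>2" using X1 by (simp add: power2_eq_square)
  also have "\<dots> \<le> Y" using G1 by (simp add: Y_def)
  finally have XY: "X \<le> Y" .
  have Y1: "1 \<le> Y" using XY X1 by linarith
  have m: "m \<le> Y" using X1 XY by linarith
  have a: "K1 * (57 + 7 * F + 60 * m) \<le> k * (124 * Y)"
    using assms(1) F m Y1 by (intro mult_le_mono) linarith+
  have b: "K2 * (23 + 60 * m) \<le> (k + 1) * (83 * Y)"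
  proof -
    have "K2 * (23 + 60 * m) \<le> (k + X) * (83 * X)" using assms(2) X1 by (intro mult_le_mono) linarith+
    also have "\<dots> \<le> ((k + 1) * X) * (83 * X)" using X1 by (intro mult_le_mono1) (simp add: algebra_simps)
    also have "\<dots> = (k + 1) * (83 * X\<^sup>2)" by (simp add: power2_eq_square algebra_simps)
    also have "\<dots> \<le> (k + 1) * (83 * Y)" using \<open>X\<^sup>2 \<le> Y\<close> by (intro mult_le_mono2)
    finally show ?thesis .
  qed
  have "83 + 14 * F + K1 * (57 + 7 * F + 60 * m) + K2 * (23 + 60 * m) \<le> 97 * Y + k * (124 * Y) + (k + 1) * (83 * Y)"
    using a b F Y1 by linarith
  also have "\<dots> \<le> (k + 1) * (207 * Y)" by (simp add: algebra_simps)
  finally have c: "Suc F * (83 + 14 * F + K1 * (57 + 7 * F + 60 * m) + K2 * (23 + 60 * m)) \<le> (2 * Y) * ((k + 1) * (207 * Y))"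
    using F Y1 by (intro mult_le_mono) linarith+
  have "34 + 7 * m + 6 * K1 \<le> (k + 1) * (47 * (Y * Y))"
  proof -
    have "34 + 7 * m + 6 * K1 \<le> 41 * Y + k * 6" using m Y1 assms(1) by linarith
    also have "\<dots> \<le> 41 * (Y * Y) + k * (6 * (Y * Y))" using Y1 by (intro add_mono mult_le_mono) simp_all
    also have "\<dots> \<le> (k + 1) * (47 * (Y * Y))" by (simp add: algebra_simps)
    finally show ?thesis .
  qed
  then have "search_time n m K1 K2 + 3 \<le> (k + 1) * (47 * (Y * Y)) + (2 * Y) * ((k + 1) * (207 * Y))"
    using c unfolding search_time_def Let_def F_def[symmetric] by linarith
  \<comment> \<open>The sum \<open>47 + 2 * 207\<close> is rounded up to \<open>2 ^ 9\<close>; these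
    9 and the 6 from squaring the \<open>2 ^ 3\<close> in \<open>G\<close> make the 15 of the
    exponent.\<close>
  also have "\<dots> \<le> (k + 1) * (512 * (Y * Y))" by (simp add: algebra_simps)
  also have "\<dots> \<le> 2 ^ k * (2 ^ 9 * (Y * Y))" by (intro mult_le_mono) (simp_all add: Suc_leI)
  also have "\<dots> = 2 ^ (6 * (Suc k)\<^sup>2 + 15 + k) * X ^ 4"
  proof -
    have "Y * Y = (2 ^ (3 * (Suc k)\<^sup>2 + 3) * 2 ^ (3 * (Suc k)\<^sup>2 + 3)) * X ^ 4"
      unfolding Y_def G_def by (simp only: power2_eq_square[of X] eval_nat_numeral(3) power_Suc power_0 ac_simps) (simp add: eval_nat_numeral)
    also have "\<dots> = 2 ^ (6 * (Suc k)\<^sup>2 + 6) * X ^ 4"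
      by (simp only: power_add[symmetric]) (simp add: algebra_simps)
    finally have "2 ^ k * (2 ^ 9 * (Y * Y)) = (2 ^ k * 2 ^ 9 * 2 ^ (6 * (Suc k)\<^sup>2 + 6)) * X ^ 4"
      by (simp only: mult.assoc)
    also have "\<dots> = 2 ^ (6 * (Suc k)\<^sup>2 + 15 + k) * X ^ 4"
      by (simp only: power_add[symmetric]) (simp add: algebra_simps)
    finally show ?thesis .
  qed
  also have "\<dots> \<le> 2 ^ 2 ^ (k + 5) * X ^ 4"
    by (intro mult_le_mono1 power_increasing exponent_bound) simp
  finally show ?thesis unfolding X_def .
qed

section \<open>A computable bound, and the three problems\<close>

definition Double_exp :: com where
  "Double_exp = Const rone 1 ;; Read rx rzero ;; Const ra 5 ;; Add rx rx ra ;; Const ry 1 ;;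
     While rx (Add ry ry ry ;; Sub rx rx rone) ;; Const re 1 ;;
     While ry (Add re re re ;; Sub ry ry rone)"

lemma ram_computable_double_exp: "ram_computable (\<lambda>k. 2 ^ 2 ^ (k + 5))"
  unfolding ram_computable_def
proof (intro exI allI)
  fix k
  define I where "I i v A t \<longleftrightarrow> v rone = 1 \<and> v rx = k + 5 - i \<and> v ry = 2 ^ i" for i and v :: vars and A :: arrs and t :: nat
  define J where "J i v A t \<longleftrightarrow> v rone = 1 \<and> v ry = 2 ^ (k + 5) - i \<and> v re = 2 ^ i" for i and v :: vars and A :: arrs and t :: nat
  have "wp [k] Double_exp (\<lambda>v A t. v re = 2 ^ 2 ^ (k + 5)) (\<lambda>_. 0) (\<lambda>_ _. 0) 0"
    unfolding Double_exp_def
    apply (simp only: wp_simps)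
    apply (rule wp_While[where I = I and n = "k + 5"])
    subgoal by (simp add: I_def read_input_def)
    subgoal by (simp add: I_def wp_simps)
    subgoal premises p for v A t
    proof -
      have "wp [k] (Const re 1 ;; While ry (Add re re re ;; Sub ry ry rone)) (\<lambda>v A t. v re = 2 ^ 2 ^ (k + 5)) v A (t + 1)"
        apply (simp only: wp_simps)
        apply (rule wp_While[where I = J and n = "2 ^ (k + 5)"])
        subgoal using p by (simp add: I_def J_def)
        subgoal by (simp add: J_def wp_simps)
        subgoal by (simp add: J_def)
        done
      then show ?thesis using p by (simp add: I_def wp_Seq[abs_def])
    qed
    done
  \<comment> \<open>A halting time is only known to exist, so the witness is named by
    choice.\<close>
  from program_run[OF this, of re]
  show "ram_halted_within (program Double_exp re) [k] (SOME T. ram_halted_within (program Double_exp re) [k] T \<and>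
      snd (ram_run (program Double_exp re) [k] T) 0 = 2 ^ 2 ^ (k + 5)) \<and>
    snd (ram_run (program Double_exp re) [k] (SOME T. ram_halted_within (program Double_exp re) [k] T \<and>
      snd (ram_run (program Double_exp re) [k] T) 0 = 2 ^ 2 ^ (k + 5))) 0 = 2 ^ 2 ^ (k + 5)"
    by (metis (mono_tags, lifting) someI_ex)
qed

text \<open>\<open>K1\<close> occurs in the exponent of the number of rounds and must be bounded by
  the parameter. \<open>K2\<close> enters the time only linearly, so it may grow with the
  graph.\<close>

lemma fpt_search:
  assumes K: "a \<in> {rk, rzero, rm}" "b \<in> {rk, rzero, rm}"
    "\<And>k m. K1 k m = (if a = rk then k else if a = rm then m else 0)"
    "\<And>k m. K2 k m = (if b = rk then k else if b = rm then m else 0)"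
    and bounds: "\<And>k m. K1 k m \<le> k" "\<And>k m. K2 k m \<le> k + m"
    and Q: "\<And>es n s t k. distinct es \<Longrightarrow>
      P n (set es) s t k \<longleftrightarrow> solution es s t (K1 k (length es)) (K2 k (length es))"
  shows "fpt_graph_problem P"
  unfolding fpt_graph_problem_def
proof (intro exI[of _ "program (Search a b) racc"] exI[of _ "\<lambda>k. 2 ^ 2 ^ (k + 5)"] exI[of _ 4] conjI
    ram_computable_double_exp allI impI)
  fix n E s t k inp
  assume V: "valid_instance n E s t" and enc: "inp \<in> graph_encodings n E s t k"
  let ?P = "program (Search a b) racc"
  obtain es where es: "distinct es" "set es = E" "inp = [n, s, t, k, length es] @ concat (map (\<lambda>(u, v). [u, v]) es)"
    using enc unfolding graph_encodings_def by blast
  let ?m = "length es"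
  have m: "card E = ?m" using es distinct_card by blast
  from V es have "set es \<subseteq> {..<n} \<times> {..<n}" "s < n" "t < n" by (auto simp: valid_instance_def)
  from program_run[OF wp_Search_program[OF this es(3) K(1,2) K(3)[of k ?m] K(4)[of k ?m]], of racc]
  obtain T r where T: "r = 1 \<longleftrightarrow> solution es s t (K1 k ?m) (K2 k ?m)" "T \<le> search_time n ?m (K1 k ?m) (K2 k ?m)"
    "ram_halted_within ?P inp (T + 3)" "snd (ram_run ?P inp (T + 3)) 0 = r"
    by blast
  have "search_time n ?m (K1 k ?m) (K2 k ?m) + 3 \<le> 2 ^ 2 ^ (k + 5) * (n + ?m + 1) ^ 4"
    by (rule search_time_bound) (rule bounds)+
  then have "T + 3 \<le> 2 ^ 2 ^ (k + 5) * (n + card E + 1) ^ 4"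
    using T(2) unfolding m by linarith
  from ram_run_halted[OF T(3) this] show "ram_decides_within ?P inp (2 ^ 2 ^ (k + 5) * (n + card E + 1) ^ 4) (P n E s t k)"
    using T Q[OF es(1)] es(2) unfolding ram_decides_within_def ram_halted_within_def by metis
qed

lemma solution_iff_trail:
  assumes "distinct es"
  shows "solution es s t K1 K2 \<longleftrightarrow> (\<exists>p. is_trail (set es) s t p \<and> K1 \<le> length p \<and> length p \<le> K1 + K2)"
  using trail_iff_iwalk[OF assms, of s t] unfolding solution_def by metis

text \<open>Makes the upper bound on the length vacuous when \<open>K2\<close> is the number of
  edges.\<close>

lemma trail_length_le:
  assumes "distinct es" "is_trail (set es) s t p"
  shows "length p \<le> length es"
  using assms is_walk_edges unfolding is_trail_def
  by (metis List.finite_set card_mono distinct_card)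

theorem mainTheorem7:
  shows "fpt_graph_problem (\<lambda>n E s t k. \<exists>es. is_trail E s t es \<and> length es = k)
       \<and> fpt_graph_problem (\<lambda>n E s t k. \<exists>es. is_trail E s t es \<and> length es \<le> k)
       \<and> fpt_graph_problem (\<lambda>n E s t k. \<exists>es. is_trail E s t es \<and> length es \<ge> k)"
proof (intro conjI)
  show "fpt_graph_problem (\<lambda>n E s t k. \<exists>es. is_trail E s t es \<and> length es = k)"
    by (rule fpt_search[where a = rk and b = rzero and ?K1.0 = "\<lambda>k m. k" and ?K2.0 = "\<lambda>k m. 0"])
      (auto simp: solution_iff_trail)
  show "fpt_graph_problem (\<lambda>n E s t k. \<exists>es. is_trail E s t es \<and> length es \<le> k)"
    by (rule fpt_search[where a = rzero and b = rk and ?K1.0 = "\<lambda>k m. 0" and ?K2.0 = "\<lambda>k m. k"])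
      (auto simp: solution_iff_trail)
  show "fpt_graph_problem (\<lambda>n E s t k. \<exists>es. is_trail E s t es \<and> length es \<ge> k)"
    by (rule fpt_search[where a = rk and b = rm and ?K1.0 = "\<lambda>k m. k" and ?K2.0 = "\<lambda>k m. m"])
      (auto simp: solution_iff_trail intro: trans_le_add2 trail_length_le)
qed

end
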